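(* For each $n\ge 3$ there exist Riemannian metrics on $\mathbb{RP}^n$ for which all equators are minimal and which do not have constant sectional curvature.
   Context: The equators of $S^n\subset\mathbb{R}^{n+1}$ are the sets $\{p\in S^n:\langle p,v\rangle=0\}$, $v\in S^n$. The equators of $\mathbb{RP}^n=S^n/\{\pm1\}$ are their images under the quotient map, i.e. the linear projective hyperplanes. "Minimal" means zero mean curvature with respect to the given metric. *)

theory Defs
  imports "HOL-Analysis.Analysis"
begin

section \<open>Smooth maps\<close>

text \<open>Only used on open sets, where it is the usual notion of a \<open>C\<^sup>k\<close> map.\<close>

primrec C_k_on :: "'a::euclidean_space set \<Rightarrow> ('a \<Rightarrow> 'b::real_normed_vector) \<Rightarrow> nat \<Rightarrow> bool" where
  "C_k_on S f 0 \<longleftrightarrow> continuous_on S f"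
| "C_k_on S f (Suc k) \<longleftrightarrow>
     (\<forall>x\<in>S. f differentiable (at x)) \<and>
     (\<forall>v. C_k_on S (\<lambda>x. frechet_derivative f (at x) v) k)"

definition smooth_map_on :: "'a::euclidean_space set \<Rightarrow> ('a \<Rightarrow> 'b::real_normed_vector) \<Rightarrow> bool" where
  "smooth_map_on S f \<longleftrightarrow> (\<forall>k. C_k_on S f k)"

section \<open>Riemannian geometry in a coordinate chart\<close>

text \<open>A metric in local coordinates is its matrix-valued function \<open>g = (g\<^sub>i\<^sub>j)\<close>.\<close>

definition partial_deriv :: "(real^'n \<Rightarrow> real) \<Rightarrow> 'n \<Rightarrow> real^'n \<Rightarrow> real" where
  "partial_deriv f i x = frechet_derivative f (at x) (axis i 1)"

definition is_metric_on :: "(real^'n) set \<Rightarrow> (real^'n \<Rightarrow> real^'n^'n) \<Rightarrow> bool" where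
  "is_metric_on S g \<longleftrightarrow>
     smooth_map_on S g \<and>
     (\<forall>x\<in>S. transpose (g x) = g x \<and> (\<forall>v. v \<noteq> 0 \<longrightarrow> v \<bullet> (g x *v v) > 0))"

definition ginner :: "(real^'n \<Rightarrow> real^'n^'n) \<Rightarrow> real^'n \<Rightarrow> real^'n \<Rightarrow> real^'n \<Rightarrow> real" where
  "ginner g x u v = u \<bullet> (g x *v v)"

text \<open>\<open>christoffel g k i j\<close> is \<open>\<Gamma>\<^sup>k\<^sub>i\<^sub>j\<close>, the Levi-Civita connection of \<open>g\<close>.\<close>

definition christoffel :: "(real^'n \<Rightarrow> real^'n^'n) \<Rightarrow> 'n \<Rightarrow> 'n \<Rightarrow> 'n \<Rightarrow> real^'n \<Rightarrow> real" where
  "christoffel g k i j x =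
     (1/2) * (\<Sum>l\<in>UNIV. matrix_inv (g x) $ k $ l *
       (partial_deriv (\<lambda>y. g y $ j $ l) i x + partial_deriv (\<lambda>y. g y $ i $ l) j x
        - partial_deriv (\<lambda>y. g y $ i $ j) l x))"

definition covariant_deriv ::
    "(real^'n \<Rightarrow> real^'n^'n) \<Rightarrow> real^'n \<Rightarrow> real^'n \<Rightarrow> (real^'n \<Rightarrow> real^'n) \<Rightarrow> real^'n" where
  "covariant_deriv g x u V =
     frechet_derivative V (at x) u +
     (\<chi> k. \<Sum>i\<in>UNIV. \<Sum>j\<in>UNIV. christoffel g k i j x * u $ i * V x $ j)"

text \<open>\<open>R(u,v)w = \<nabla>\<^sub>u\<nabla>\<^sub>v w - \<nabla>\<^sub>v\<nabla>\<^sub>u w - \<nabla>\<^sub>[\<^sub>u\<^sub>,\<^sub>v\<^sub>] w\<close>.\<close>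

definition riemann_tensor ::
    "(real^'n \<Rightarrow> real^'n^'n) \<Rightarrow> real^'n \<Rightarrow> real^'n \<Rightarrow> real^'n \<Rightarrow> real^'n \<Rightarrow> real^'n" where
  "riemann_tensor g x u v w =
     (\<chi> l. \<Sum>i\<in>UNIV. \<Sum>j\<in>UNIV. \<Sum>k\<in>UNIV.
        (partial_deriv (christoffel g l j k) i x - partial_deriv (christoffel g l i k) j x
         + (\<Sum>m\<in>UNIV. christoffel g l i m x * christoffel g m j k x
                    - christoffel g l j m x * christoffel g m i k x))
        * u $ i * v $ j * w $ k)"

text \<open>Meaningful for linearly independent \<open>u\<close>, \<open>v\<close>.\<close>

definition sectional_curvature ::
    "(real^'n \<Rightarrow> real^'n^'n) \<Rightarrow> real^'n \<Rightarrow> real^'n \<Rightarrow> real^'n \<Rightarrow> real" where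
  "sectional_curvature g x u v =
     ginner g x (riemann_tensor g x u v v) u /
     (ginner g x u u * ginner g x v v - (ginner g x u v)\<^sup>2)"

subsection \<open>Mean curvature of level sets\<close>

definition gradient :: "(real^'n \<Rightarrow> real^'n^'n) \<Rightarrow> (real^'n \<Rightarrow> real) \<Rightarrow> real^'n \<Rightarrow> real^'n" where
  "gradient g f x = matrix_inv (g x) *v (\<chi> i. partial_deriv f i x)"

definition unit_normal :: "(real^'n \<Rightarrow> real^'n^'n) \<Rightarrow> (real^'n \<Rightarrow> real) \<Rightarrow> real^'n \<Rightarrow> real^'n" where
  "unit_normal g f x =
     (1 / sqrt (ginner g x (gradient g f x) (gradient g f x))) *\<^sub>R gradient g f x"

definition level_tangent :: "(real^'n \<Rightarrow> real) \<Rightarrow> real^'n \<Rightarrow> (real^'n) set" where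
  "level_tangent f x = {u. frechet_derivative f (at x) u = 0}"

definition second_fundamental_form ::
    "(real^'n \<Rightarrow> real^'n^'n) \<Rightarrow> (real^'n \<Rightarrow> real) \<Rightarrow> real^'n \<Rightarrow> real^'n \<Rightarrow> real^'n \<Rightarrow> real" where
  "second_fundamental_form g f x u v = - ginner g x (covariant_deriv g x u (unit_normal g f)) v"

definition orthonormal_basis_of ::
    "(real^'n \<Rightarrow> real^'n^'n) \<Rightarrow> real^'n \<Rightarrow> (real^'n) set \<Rightarrow> (real^'n) set \<Rightarrow> bool" where
  "orthonormal_basis_of g x T E \<longleftrightarrow>
     finite E \<and> span E = T \<and>
     (\<forall>u\<in>E. \<forall>v\<in>E. ginner g x u v = (if u = v then 1 else 0))"

text \<open>The mean curvature is the trace of the second fundamental form; the sum below has the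
  same value for every orthonormal basis of the tangent space.\<close>

definition zero_mean_curvature_at ::
    "(real^'n \<Rightarrow> real^'n^'n) \<Rightarrow> (real^'n \<Rightarrow> real) \<Rightarrow> real^'n \<Rightarrow> bool" where
  "zero_mean_curvature_at g f x \<longleftrightarrow>
     (\<forall>E. orthonormal_basis_of g x (level_tangent f x) E \<longrightarrow>
          (\<Sum>e\<in>E. second_fundamental_form g f x e e) = 0)"

section \<open>Real projective space\<close>

text \<open>With \<open>n = CARD('n)\<close>, the space \<open>\<real>\<^sup>n\<^sup>+\<^sup>1\<close> is \<^typ>\<open>real^('n option)\<close>, and the sphere
  \<open>S\<^sup>n\<close> is its unit sphere.\<close>

definition proj_class :: "real^('n::finite option) \<Rightarrow> (real^('n option)) set" where
  "proj_class p = {p, - p}"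

definition RP :: "(real^('n::finite option)) set set" where
  "RP = proj_class ` sphere 0 1"

definition sphere_equator :: "real^('n::finite option) \<Rightarrow> (real^('n option)) set" where
  "sphere_equator v = {p \<in> sphere 0 1. p \<bullet> v = 0}"

definition RP_equators :: "(real^('n::finite option)) set set set" where
  "RP_equators = {proj_class ` sphere_equator v | v. v \<in> sphere 0 1}"

subsection \<open>The standard affine atlas\<close>

text \<open>\<open>slot i\<close> is a bijection from the \<open>n\<close> chart coordinates onto the homogeneous coordinates
  other than the \<open>i\<close>-th one. It makes the \<open>i\<close>-th affine chart \<open>[p] \<mapsto> (p\<^sub>j / p\<^sub>i)\<^sub>j\<^sub>\<noteq>\<^sub>i\<close> take values in
  \<^typ>\<open>real^'n\<close>.\<close>

definition slot :: "'n option \<Rightarrow> 'n \<Rightarrow> 'n option" where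
  "slot i l = (if i = Some l then None else Some l)"

lemma bij_betw_slot: "bij_betw (slot i) UNIV (- {i})"
proof (rule bij_betwI')
  fix y assume "y \<in> - {i}"
  then show "\<exists>x\<in>UNIV. y = slot i x"
    by (intro bexI[of _ "case y of None \<Rightarrow> the i | Some l \<Rightarrow> l"])
      (auto simp: slot_def split: option.splits)
qed (auto simp: slot_def split: if_splits)

definition chart_domain :: "'n::finite option \<Rightarrow> (real^('n option)) set set" where
  "chart_domain i = {P \<in> RP. \<forall>p\<in>P. p $ i \<noteq> 0}"

text \<open>The value does not depend on which of the two representatives is selected.\<close>

definition chart :: "'n::finite option \<Rightarrow> (real^('n option)) set \<Rightarrow> real^'n" where
  "chart i P = (let p = (SOME p. p \<in> P) in \<chi> l. p $ slot i l / p $ i)"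

definition homogenize :: "'n::finite option \<Rightarrow> real^'n \<Rightarrow> real^('n option)" where
  "homogenize i x = (\<chi> j. if j = i then 1 else x $ inv (slot i) j)"

definition param :: "'n::finite option \<Rightarrow> real^'n \<Rightarrow> (real^('n option)) set" where
  "param i x = proj_class (homogenize i x /\<^sub>R norm (homogenize i x))"

lemma slot_neq: "slot i l \<noteq> i"
  by (auto simp: slot_def)

lemma inj_slot: "inj (slot i)"
  using bij_betw_slot bij_betw_imp_inj_on by blast

lemma slot_inv: "j \<noteq> i \<Longrightarrow> slot i (inv (slot i) j) = j"
  using bij_betw_slot[of i] by (intro f_inv_into_f) (auto simp: bij_betw_def)

lemma chart_proj_class: "chart i (proj_class p) = (\<chi> l. p $ slot i l / p $ i)"
proof -
  have "(SOME q. q \<in> proj_class p) \<in> proj_class p"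
    by (rule someI[of _ p]) (simp add: proj_class_def)
  then have "(SOME q. q \<in> proj_class p) = p \<or> (SOME q. q \<in> proj_class p) = - p"
    by (simp add: proj_class_def)
  then show ?thesis
    by (auto simp: chart_def Let_def vec_eq_iff)
qed

lemma homogenize_nonzero: "homogenize i x \<noteq> 0"
proof -
  have "homogenize i x $ i = 1"
    by (simp add: homogenize_def)
  then show ?thesis by (metis zero_index zero_neq_one)
qed

lemma param_in_chart_domain: "param i x \<in> chart_domain i"
proof -
  have "homogenize i x $ i = 1"
    by (simp add: homogenize_def)
  then show ?thesis
    by (auto simp: param_def chart_domain_def RP_def proj_class_def homogenize_nonzero)
qed

lemma chart_param: "chart i (param i x) = x"
proof -
  have "norm (homogenize i x) \<noteq> 0"
    by (simp add: homogenize_nonzero)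
  moreover have "homogenize i x $ slot i l / homogenize i x $ i = x $ l" for l
    by (simp add: homogenize_def slot_neq inv_f_f[OF inj_slot])
  ultimately show ?thesis
    by (simp add: param_def chart_proj_class vec_eq_iff del: norm_eq_zero)
qed

lemma param_chart:
  assumes "P \<in> chart_domain i"
  shows "param i (chart i P) = P"
proof -
  obtain p where p: "norm p = 1" "P = proj_class p"
    using assms by (auto simp: chart_domain_def RP_def)
  have pi: "p $ i \<noteq> 0"
    using assms p by (auto simp: chart_domain_def proj_class_def)
  have h: "homogenize i (chart i P) = p /\<^sub>R (p $ i)"
    using pi by (auto simp: p chart_proj_class homogenize_def vec_eq_iff slot_inv field_simps)
  have "homogenize i (chart i P) /\<^sub>R norm (homogenize i (chart i P)) = sgn (p $ i) *\<^sub>R p"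
    using pi p(1) unfolding h by (simp add: sgn_real_def)
  then show ?thesis
    using pi by (auto simp: param_def p(2) proj_class_def sgn_real_def)
qed

lemma RP_covered: "(\<Union>i. chart_domain i) = (RP :: (real^('n::finite option)) set set)"
proof -
  have "\<exists>i. P \<in> chart_domain i" if P: "P \<in> RP" for P :: "(real^('n option)) set"
  proof -
    obtain p where p: "norm p = 1" "P = proj_class p"
      using P by (auto simp: RP_def)
    then have "p \<noteq> 0" by auto
    then obtain i where "p $ i \<noteq> 0"
      by (auto simp: vec_eq_iff)
    then show ?thesis
      using p P by (auto simp: chart_domain_def proj_class_def)
  qed
  moreover have "chart_domain i \<subseteq> RP" for i :: "'n option"
    by (auto simp: chart_domain_def)
  ultimately show ?thesis by blast
qed

subsection \<open>Metrics, minimal hypersurfaces and curvature\<close>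

text \<open>A Riemannian metric on projective space is given by its coordinate matrices in the charts
  of the affine atlas, subject to the tensor transformation law on overlaps.\<close>

type_synonym 'n RP_tensor = "'n option \<Rightarrow> real^'n \<Rightarrow> real^'n^'n"

definition is_riemannian_metric_RP :: "'n::finite RP_tensor \<Rightarrow> bool" where
  "is_riemannian_metric_RP G \<longleftrightarrow>
     (\<forall>i. is_metric_on UNIV (G i)) \<and>
     (\<forall>i j x. param i x \<in> chart_domain j \<longrightarrow>
        (let \<tau> = (\<lambda>y. chart j (param i y)); T = frechet_derivative \<tau> (at x)
         in \<forall>u v. ginner (G i) x u v = ginner (G j) (\<tau> x) (T u) (T v)))"

text \<open>\<open>\<Sigma>\<close> is a hypersurface (locally the zero set of a smooth function with nowhere vanishing
  differential) and has zero mean curvature at each of its points.\<close>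

definition is_minimal_hypersurface_RP ::
    "'n::finite RP_tensor \<Rightarrow> (real^('n option)) set set \<Rightarrow> bool" where
  "is_minimal_hypersurface_RP G \<Sigma> \<longleftrightarrow>
     \<Sigma> \<subseteq> RP \<and>
     (\<forall>i x. param i x \<in> \<Sigma> \<longrightarrow>
        (\<exists>V f. open V \<and> x \<in> V \<and> smooth_map_on V f \<and>
           (\<forall>y\<in>V. frechet_derivative f (at y) \<noteq> (\<lambda>_. 0)) \<and>
           {y \<in> V. param i y \<in> \<Sigma>} = {y \<in> V. f y = 0} \<and>
           (\<forall>y\<in>V. f y = 0 \<longrightarrow> zero_mean_curvature_at (G i) f y)))"

definition has_constant_sectional_curvature_RP :: "'n::finite RP_tensor \<Rightarrow> bool" where
  "has_constant_sectional_curvature_RP G \<longleftrightarrow>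
     (\<exists>c. \<forall>i x u v. u \<noteq> v \<and> independent {u, v} \<longrightarrow> sectional_curvature (G i) x u v = c)"

end

theory Submission
  imports Defs
begin

text \<open>In an affine chart the equators are the affine hyperplanes. For a metric \<open>g = \<phi> K\<close>, all of
  them are minimal as soon as \<open>K\<close> is a Killing tensor of the flat connection, i.e. the symmetrised
  derivative of \<open>K\<close> vanishes, and \<open>\<phi> = (det K) powr (- 2 / (n - 1))\<close>. Killing tensors of this kind
  come from quadratic forms on \<open>\<Lambda>\<^sup>2 \<real>\<^sup>n\<^sup>+\<^sup>1\<close> by \<open>K\<^sub>X(U, U) = Q(X \<and> U)\<close>, and \<open>Q = |\<cdot>|\<^sup>2\<close> gives the round
  metric. Adding the square of a single coordinate of \<open>X \<and> U\<close> is a rank-one perturbation, so that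
  the determinant and the inverse of \<open>K\<close> are explicit, and it destroys constant curvature when
  \<open>n \<ge> 3\<close>.\<close>

text \<open>For a constant vector u tangent to a hyperplane with unit normal N, the second
  fundamental form is (D_u g)(u, N) - (D_N g)(u, u) / 2. The Killing equation rewrites (D_u K)(u, N)
  as - (D_N K)(u, u) / 2, so only derivatives along N survive. Their tangential trace equals the
  full trace because (D_N K)(N, N) = 0, and the full trace is a logarithmic derivative of det K; the
  exponent - 2 / (n - 1) is the one that cancels it. The same exponent makes phi K invariant under
  rescaling of homogeneous coordinates, hence well defined on projective space. With r = 1 + |x|^2,
  the form r I - x x^T has determinant r^(n-1) and inverse (I + x x^T) / r. Adding w w^T multiplies
  the determinant by 1 + q / r, where q = \<open>bivector_norm w x\<close>; this gives the base
  r^(n-2) (r + q). The determinant itself is never formalised: the trace identity is verified with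
  the explicit inverse. For n = 2 minimal equators are geodesics and Beltrami's theorem forces
  constant curvature; the counterexample needs a third direction.\<close>

section \<open>Calculus of smooth maps\<close>

lemma C_k_on_cong:
  assumes "open S" "\<And>x. x \<in> S \<Longrightarrow> f x = g x" "C_k_on S f k"
  shows "C_k_on S g k"
  using assms(2,3)
proof (induction k arbitrary: f g)
  case 0
  then show ?case by (metis C_k_on.simps(1) continuous_on_cong)
next
  case (Suc k)
  have der: "(g has_derivative frechet_derivative f (at x)) (at x)" if "x \<in> S" for x
  proof -
    have "(f has_derivative frechet_derivative f (at x)) (at x)"
      using Suc.prems(2) that frechet_derivative_works by (metis C_k_on.simps(2))
    then show ?thesis
      using has_derivative_transform_within_open[OF _ assms(1) that] Suc.prems(1) by blast
  qed
  have eq: "frechet_derivative f (at x) = frechet_derivative g (at x)" if "x \<in> S" for x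
    using der[OF that] by (rule frechet_derivative_at)
  have "C_k_on S (\<lambda>x. frechet_derivative g (at x) v) k" for v
    using Suc.IH[of "\<lambda>x. frechet_derivative f (at x) v" "\<lambda>x. frechet_derivative g (at x) v"]
      Suc.prems(2) eq by simp
  with der show ?case by (auto simp: differentiable_def)
qed

text \<open>Allows an explicit derivative formula in place of \<open>frechet_derivative\<close>, so
  that the inductions below run on the usual product and chain rules.\<close>

lemma C_k_on_SucI:
  assumes "open S" "\<And>x. x \<in> S \<Longrightarrow> (f has_derivative f' x) (at x)"
    "\<And>v. C_k_on S (\<lambda>x. f' x v) k"
  shows "C_k_on S f (Suc k)"
proof -
  have eq: "f' x = frechet_derivative f (at x)" if "x \<in> S" for x
    using assms(2)[OF that] by (rule frechet_derivative_at)
  have "C_k_on S (\<lambda>x. frechet_derivative f (at x) v) k" for v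
    by (rule C_k_on_cong[OF assms(1) _ assms(3)[of v]]) (simp add: eq)
  with assms(2) show ?thesis by (auto simp: differentiable_def)
qed

lemma C_k_on_Suc_has_derivative:
  "C_k_on S f (Suc k) \<Longrightarrow> x \<in> S \<Longrightarrow> (f has_derivative frechet_derivative f (at x)) (at x)"
  using frechet_derivative_works by (metis C_k_on.simps(2))

lemma C_k_on_Suc_imp: "C_k_on S f (Suc k) \<Longrightarrow> C_k_on S f k"
proof (induction k arbitrary: f)
  case 0
  then show ?case
    by (auto intro!: continuous_at_imp_continuous_on dest: differentiable_imp_continuous_within)
next
  case (Suc k)
  then show ?case by (metis C_k_on.simps(2))
qed

lemma C_k_on_const: "open S \<Longrightarrow> C_k_on S (\<lambda>x. c) k"
proof (induction k arbitrary: c)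
  case (Suc k)
  then show ?case by (intro C_k_on_SucI[where f' = "\<lambda>_ _. 0"]) auto
qed simp

lemma C_k_on_add:
  assumes "open S"
  shows "C_k_on S f k \<Longrightarrow> C_k_on S g k \<Longrightarrow> C_k_on S (\<lambda>x. f x + g x) k"
proof (induction k arbitrary: f g)
  case (Suc k)
  then show ?case
    by (intro C_k_on_SucI[OF assms has_derivative_add[OF C_k_on_Suc_has_derivative
            C_k_on_Suc_has_derivative]]) auto
qed (simp add: continuous_on_add)

lemma C_k_on_bounded_linear_compose:
  assumes "open S" "bounded_linear L"
  shows "C_k_on S f k \<Longrightarrow> C_k_on S (\<lambda>x. L (f x)) k"
proof (induction k arbitrary: f)
  case 0
  then show ?case using assms(2) by (simp add: bounded_linear.continuous_on)
next
  case (Suc k)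
  then show ?case
    by (intro C_k_on_SucI[OF assms(1) bounded_linear.has_derivative[OF assms(2)
            C_k_on_Suc_has_derivative]]) auto
qed

lemma C_k_on_mult:
  fixes f g :: "'a::euclidean_space \<Rightarrow> real"
  assumes "open S"
  shows "C_k_on S f k \<Longrightarrow> C_k_on S g k \<Longrightarrow> C_k_on S (\<lambda>x. f x * g x) k"
proof (induction k arbitrary: f g)
  case (Suc k)
  note fg = Suc.prems
  show ?case
  proof (rule C_k_on_SucI[OF assms has_derivative_mult[OF C_k_on_Suc_has_derivative[OF fg(1)]
            C_k_on_Suc_has_derivative[OF fg(2)]]])
    fix v
    show "C_k_on S (\<lambda>x. f x * frechet_derivative g (at x) v + frechet_derivative f (at x) v * g x) k"
      using fg C_k_on_Suc_imp[OF fg(1)] C_k_on_Suc_imp[OF fg(2)]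
      by (intro C_k_on_add assms Suc.IH) auto
  qed
qed (simp add: continuous_on_mult)

text \<open>The induction generalises the exponent, since each differentiation lowers it by
  one.\<close>

lemma C_k_on_powr:
  fixes f :: "'a::euclidean_space \<Rightarrow> real"
  assumes "open S" "\<And>x. x \<in> S \<Longrightarrow> f x > 0"
  shows "C_k_on S f k \<Longrightarrow> C_k_on S (\<lambda>x. f x powr a) k"
proof (induction k arbitrary: a)
  case 0
  then have "continuous_on S f" by simp
  moreover have "\<forall>x\<in>S. f x \<noteq> 0" using assms(2) by force
  ultimately show ?case by (simp add: continuous_on_powr)
next
  case (Suc k)
  note f = Suc.prems
  show ?case
  proof (rule C_k_on_SucI[OF assms(1)])
    fix x assume x: "x \<in> S"
    show "((\<lambda>x. f x powr a) has_derivative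
        (\<lambda>v. a * (f x powr (a - 1) * frechet_derivative f (at x) v))) (at x)"
      using C_k_on_Suc_has_derivative[OF f x] assms(2)[OF x]
      by (auto intro!: derivative_eq_intros simp: powr_diff field_simps)
  next
    fix v
    show "C_k_on S (\<lambda>x. a * (f x powr (a - 1) * frechet_derivative f (at x) v)) k"
      using f C_k_on_Suc_imp[OF f]
      by (intro C_k_on_mult C_k_on_const Suc.IH assms(1)) auto
  qed
qed

lemma smooth_map_on_const: "open S \<Longrightarrow> smooth_map_on S (\<lambda>x. c)"
  by (simp add: smooth_map_on_def C_k_on_const)

lemma smooth_map_on_bounded_linear:
  assumes "open S" "bounded_linear L"
  shows "smooth_map_on S L"
proof -
  have "C_k_on S L k" for k
  proof (cases k)
    case 0
    then show ?thesis using assms(2) by (simp add: linear_continuous_on)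
  next
    case (Suc k')
    have "C_k_on S L (Suc k')"
      by (rule C_k_on_SucI[OF assms(1) bounded_linear_imp_has_derivative[OF assms(2)]
            C_k_on_const[OF assms(1)]])
    with Suc show ?thesis by simp
  qed
  then show ?thesis by (simp add: smooth_map_on_def)
qed

lemma smooth_map_on_add:
  "open S \<Longrightarrow> smooth_map_on S f \<Longrightarrow> smooth_map_on S g \<Longrightarrow> smooth_map_on S (\<lambda>x. f x + g x)"
  by (simp add: smooth_map_on_def C_k_on_add)

lemma smooth_map_on_bounded_linear_compose:
  "open S \<Longrightarrow> bounded_linear L \<Longrightarrow> smooth_map_on S f \<Longrightarrow> smooth_map_on S (\<lambda>x. L (f x))"
  by (simp add: smooth_map_on_def C_k_on_bounded_linear_compose)

lemma smooth_map_on_mult: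
  fixes f g :: "'a::euclidean_space \<Rightarrow> real"
  shows "open S \<Longrightarrow> smooth_map_on S f \<Longrightarrow> smooth_map_on S g \<Longrightarrow> smooth_map_on S (\<lambda>x. f x * g x)"
  by (simp add: smooth_map_on_def C_k_on_mult)

lemma smooth_map_on_power:
  fixes f :: "'a::euclidean_space \<Rightarrow> real"
  shows "open S \<Longrightarrow> smooth_map_on S f \<Longrightarrow> smooth_map_on S (\<lambda>x. f x ^ m)"
  by (induction m) (auto intro: smooth_map_on_const smooth_map_on_mult)

lemma smooth_map_on_powr:
  fixes f :: "'a::euclidean_space \<Rightarrow> real"
  shows "open S \<Longrightarrow> (\<And>x. x \<in> S \<Longrightarrow> f x > 0) \<Longrightarrow> smooth_map_on S f \<Longrightarrow>
    smooth_map_on S (\<lambda>x. f x powr a)"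
  by (simp add: smooth_map_on_def C_k_on_powr)

lemma smooth_map_on_sum:
  "open S \<Longrightarrow> (\<And>i. i \<in> I \<Longrightarrow> smooth_map_on S (f i)) \<Longrightarrow> smooth_map_on S (\<lambda>x. \<Sum>i\<in>I. f i x)"
  by (induction I rule: infinite_finite_induct)
    (auto intro: smooth_map_on_const smooth_map_on_add)

lemma smooth_map_on_euclidean:
  fixes f :: "'a::euclidean_space \<Rightarrow> 'b::euclidean_space"
  assumes "open S" "\<And>b. b \<in> Basis \<Longrightarrow> smooth_map_on S (\<lambda>x. f x \<bullet> b)"
  shows "smooth_map_on S f"
proof -
  have "smooth_map_on S (\<lambda>x. \<Sum>b\<in>Basis. (f x \<bullet> b) *\<^sub>R b)"
    by (intro smooth_map_on_sum assms(1)
        smooth_map_on_bounded_linear_compose[OF _ bounded_linear_scaleR_left] assms(2))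
  then show ?thesis by (simp add: euclidean_representation)
qed

lemma smooth_map_on_inner:
  fixes f g :: "'a::euclidean_space \<Rightarrow> 'b::euclidean_space"
  assumes "open S" "smooth_map_on S f" "smooth_map_on S g"
  shows "smooth_map_on S (\<lambda>x. f x \<bullet> g x)"
  by (subst euclidean_inner) (intro smooth_map_on_sum smooth_map_on_mult assms
      smooth_map_on_bounded_linear_compose[OF _ bounded_linear_inner_left])

section \<open>The second fundamental form of affine level sets\<close>

lemma invertible_pos_def:
  fixes M :: "real^'n^'n"
  assumes "\<And>v. v \<noteq> 0 \<Longrightarrow> v \<bullet> (M *v v) > 0"
  shows "invertible M"
proof -
  have "M *v v = 0 \<Longrightarrow> v = 0" for v
    using assms[of v] by force
  then show ?thesis
    using matrix_left_invertible_ker invertible_left_inverse by blast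
qed

lemma matrix_mul_matrix_inv:
  fixes M :: "real^'n^'n"
  assumes "invertible M"
  shows "M ** matrix_inv M = mat 1"
  unfolding matrix_inv_def using someI_ex[OF assms[unfolded invertible_def]] by blast

lemma inner_matrix_vector_swap:
  fixes M :: "real^'n^'n"
  assumes "transpose M = M"
  shows "u \<bullet> (M *v v) = v \<bullet> (M *v u)"
  by (metis assms dot_lmul_matrix inner_commute transpose_matrix_vector)

lemma inner_matrix_vector_sum:
  fixes M :: "real^'n^'n"
  shows "u \<bullet> (M *v v) = (\<Sum>i\<in>UNIV. \<Sum>j\<in>UNIV. M $ i $ j * u $ i * v $ j)"
  by (simp add: inner_vec_def matrix_vector_mult_def sum_distrib_left mult_ac)

lemma has_derivative_entry:
  fixes g :: "'a::real_normed_vector \<Rightarrow> real^'n^'m"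
  assumes "(g has_derivative D) F"
  shows "((\<lambda>y. g y $ j $ l) has_derivative (\<lambda>d. D d $ j $ l)) F"
  by (intro bounded_linear.has_derivative[OF bounded_linear_vec_nth] assms)

lemma partial_deriv_eqI:
  "(f has_derivative f') (at x) \<Longrightarrow> partial_deriv f i x = f' (axis i 1)"
  unfolding partial_deriv_def by (metis frechet_derivative_at)

lemma has_derivative_symmetric:
  fixes g :: "real^'n \<Rightarrow> real^'n^'n"
  assumes "(g has_derivative D) (at x)" "\<And>y. transpose (g y) = g y"
  shows "transpose (D d) = D d"
proof -
  have "g y $ i $ j = g y $ j $ i" for y i j
    by (metis assms(2) transpose_def vec_lambda_beta)
  then have "(\<lambda>d. D d $ i $ j) = (\<lambda>d. D d $ j $ i)" for i j
    using has_derivative_entry[OF assms(1), of i j] has_derivative_entry[OF assms(1), of j i]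
    by (auto intro: has_derivative_unique)
  then have "D d $ i $ j = D d $ j $ i" for i j by metis
  then show ?thesis by (simp add: vec_eq_iff transpose_def)
qed

lemma linear_matrix_axis_expansion:
  fixes D :: "real^'n \<Rightarrow> real^'m^'k"
  assumes "linear D"
  shows "D u $ j $ l = (\<Sum>i\<in>UNIV. u $ i * D (axis i 1) $ j $ l)"
proof -
  have "D u = D (\<Sum>i\<in>UNIV. u $ i *\<^sub>R axis i 1)"
    by (simp add: basis_expansion flip: scalar_mult_eq_scaleR)
  also have "\<dots> = (\<Sum>i\<in>UNIV. u $ i *\<^sub>R D (axis i 1))"
    by (simp add: linear_sum[OF assms] linear_cmul[OF assms])
  finally show ?thesis by simp
qed

text \<open>Contracting with the metric cancels the inverse matrix in the Christoffel symbols. What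
  remains is the Koszul formula for constant vector fields, involving only first derivatives of
  \<open>g\<close>.\<close>

lemma koszul_formula:
  fixes g :: "real^'n \<Rightarrow> real^'n^'n"
  assumes D: "(g has_derivative D) (at x)" and sym: "transpose (g x) = g x"
    and inv: "invertible (g x)"
  shows "ginner g x (\<chi> k. \<Sum>i\<in>UNIV. \<Sum>j\<in>UNIV. christoffel g k i j x * u $ i * v $ j) w =
    (v \<bullet> (D u *v w) + u \<bullet> (D v *v w) - u \<bullet> (D w *v v)) / 2"
proof -
  let ?e = "\<lambda>i::'n. axis i (1::real)"
  have lin: "linear D" using D has_derivative_linear by blast
  \<comment> \<open>\<open>t\<close> is twice the Christoffel symbol of the first kind, and
    \<open>T\<close> is its contraction with \<open>u\<close> and \<open>v\<close>.\<close>
  define t where "t i j l = D (?e i) $ j $ l + D (?e j) $ i $ l - D (?e l) $ i $ j" for i j l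
  define T where "T = (\<chi> l. \<Sum>i\<in>UNIV. \<Sum>j\<in>UNIV. t i j l * u $ i * v $ j)"
  have chr: "christoffel g k i j x = 1/2 * (\<Sum>l\<in>UNIV. matrix_inv (g x) $ k $ l * t i j l)" for k i j
    unfolding christoffel_def t_def partial_deriv_eqI[OF has_derivative_entry[OF D]] ..
  have swap: "(\<Sum>i\<in>UNIV. \<Sum>j\<in>UNIV. \<Sum>l\<in>UNIV. F i j l) = (\<Sum>l\<in>UNIV. \<Sum>i\<in>UNIV. \<Sum>j\<in>UNIV. F i j l)"
    for F :: "'n \<Rightarrow> 'n \<Rightarrow> 'n \<Rightarrow> real"
    by (rule trans[OF sum.cong[OF refl sum.swap] sum.swap])
  have "(\<Sum>i\<in>UNIV. \<Sum>j\<in>UNIV. christoffel g k i j x * u $ i * v $ j) =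
      1/2 * (\<Sum>l\<in>UNIV. \<Sum>i\<in>UNIV. \<Sum>j\<in>UNIV. matrix_inv (g x) $ k $ l * (t i j l * u $ i * v $ j))" for k
    by (subst swap[symmetric]) (simp add: chr sum_distrib_left sum_distrib_right mult_ac)
  then have G: "(\<chi> k. \<Sum>i\<in>UNIV. \<Sum>j\<in>UNIV. christoffel g k i j x * u $ i * v $ j) =
      (1/2) *\<^sub>R (matrix_inv (g x) *v T)"
    by (simp add: vec_eq_iff matrix_vector_mult_def T_def sum_distrib_left)
  have "ginner g x (\<chi> k. \<Sum>i\<in>UNIV. \<Sum>j\<in>UNIV. christoffel g k i j x * u $ i * v $ j) w =
      w \<bullet> (g x *v ((1/2) *\<^sub>R (matrix_inv (g x) *v T)))"
    unfolding G ginner_def by (rule inner_matrix_vector_swap[OF sym])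
  also have "\<dots> = (w \<bullet> T) / 2"
    by (simp add: matrix_vector_mult_scaleR matrix_vector_mul_assoc matrix_mul_matrix_inv[OF inv])
  also have "w \<bullet> T = v \<bullet> (D u *v w) + u \<bullet> (D v *v w) - u \<bullet> (D w *v v)"
  proof -
    have 1: "v \<bullet> (D u *v w) = (\<Sum>l\<in>UNIV. \<Sum>i\<in>UNIV. \<Sum>j\<in>UNIV. D (?e i) $ j $ l * u $ i * v $ j * w $ l)"
    proof -
      have "v \<bullet> (D u *v w) =
          (\<Sum>j\<in>UNIV. \<Sum>l\<in>UNIV. \<Sum>i\<in>UNIV. D (?e i) $ j $ l * u $ i * v $ j * w $ l)"
        unfolding inner_matrix_vector_sum linear_matrix_axis_expansion[OF lin, of u]
        by (simp add: sum_distrib_left sum_distrib_right mult_ac)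
      also have "\<dots> = (\<Sum>i\<in>UNIV. \<Sum>j\<in>UNIV. \<Sum>l\<in>UNIV. D (?e i) $ j $ l * u $ i * v $ j * w $ l)"
        by (rule swap)
      also note swap
      finally show ?thesis .
    qed
    have 2: "u \<bullet> (D v *v w) = (\<Sum>l\<in>UNIV. \<Sum>i\<in>UNIV. \<Sum>j\<in>UNIV. D (?e j) $ i $ l * u $ i * v $ j * w $ l)"
    proof -
      have "u \<bullet> (D v *v w) =
          (\<Sum>i\<in>UNIV. \<Sum>l\<in>UNIV. \<Sum>j\<in>UNIV. D (?e j) $ i $ l * u $ i * v $ j * w $ l)"
        unfolding inner_matrix_vector_sum linear_matrix_axis_expansion[OF lin, of v]
        by (simp add: sum_distrib_left sum_distrib_right mult_ac)
      also have "\<dots> = (\<Sum>l\<in>UNIV. \<Sum>i\<in>UNIV. \<Sum>j\<in>UNIV. D (?e j) $ i $ l * u $ i * v $ j * w $ l)"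
        by (rule sum.swap)
      finally show ?thesis .
    qed
    have 3: "u \<bullet> (D w *v v) = (\<Sum>l\<in>UNIV. \<Sum>i\<in>UNIV. \<Sum>j\<in>UNIV. D (?e l) $ i $ j * u $ i * v $ j * w $ l)"
    proof -
      have "u \<bullet> (D w *v v) =
          (\<Sum>i\<in>UNIV. \<Sum>j\<in>UNIV. \<Sum>l\<in>UNIV. D (?e l) $ i $ j * u $ i * v $ j * w $ l)"
        unfolding inner_matrix_vector_sum linear_matrix_axis_expansion[OF lin, of w]
        by (simp add: sum_distrib_left sum_distrib_right mult_ac)
      also note swap
      finally show ?thesis .
    qed
    have "w \<bullet> T = (\<Sum>l\<in>UNIV. \<Sum>i\<in>UNIV. \<Sum>j\<in>UNIV. t i j l * u $ i * v $ j * w $ l)"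
      by (simp add: T_def inner_vec_def sum_distrib_left mult_ac)
    then show ?thesis
      unfolding 1 2 3 t_def by (simp add: algebra_simps sum.distrib sum_subtractf)
  qed
  finally show ?thesis .
qed

lemma has_derivative_matrix_vector_mult:
  fixes g :: "'a::real_normed_vector \<Rightarrow> real^'n^'m"
  assumes "(g has_derivative D) (at x)" "(V has_derivative D') (at x)"
  shows "((\<lambda>y. g y *v V y) has_derivative (\<lambda>d. g x *v D' d + D d *v V x)) (at x)"
  by (rule bounded_bilinear.FDERIV[OF _ assms])
    (simp add: bilinear_conv_bounded_bilinear[symmetric] bilinear_def linear_iff
      matrix_vector_mult_add_rdistrib matrix_vector_right_distrib matrix_vector_mult_scaleR
      scaleR_matrix_vector_assoc)

lemma differentiable_matrix_vector_mult:
  fixes g :: "'a::real_normed_vector \<Rightarrow> real^'n^'m"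
  assumes "g differentiable (at x)" "V differentiable (at x)"
  shows "(\<lambda>y. g y *v V y) differentiable (at x)"
  using assms has_derivative_matrix_vector_mult unfolding differentiable_def by blast

lemma has_derivative_affine_functional:
  fixes a :: "'a::real_inner"
  shows "((\<lambda>y. a \<bullet> y + b) has_derivative (\<lambda>d. a \<bullet> d)) (at x)"
  by (auto intro!: derivative_eq_intros)

text \<open>The differential of \<open>f\<close> is the constant covector \<open>a\<close>, so a
  vector tangent to one level set is tangent to all of them and no second derivative of
  \<open>f\<close> enters.\<close>

locale affine_level_sets =
  fixes g :: "real^'n \<Rightarrow> real^'n^'n" and a :: "real^'n" and b :: real and f :: "real^'n \<Rightarrow> real"
  assumes sym: "transpose (g x) = g x"
    and pos: "v \<noteq> 0 \<Longrightarrow> v \<bullet> (g x *v v) > 0"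
    and nonzero: "a \<noteq> 0"
    and affine: "f x = a \<bullet> x + b"
begin

lemma inv: "invertible (g x)"
  using pos by (rule invertible_pos_def)

lemma has_derivative_f: "(f has_derivative (\<lambda>d. a \<bullet> d)) (at x)"
proof -
  have "f = (\<lambda>y. a \<bullet> y + b)" using affine by blast
  then show ?thesis by (simp add: has_derivative_affine_functional)
qed

lemma level_tangent: "level_tangent f x = {u. a \<bullet> u = 0}"
  unfolding level_tangent_def frechet_derivative_at[OF has_derivative_f, symmetric] ..

lemma gradient: "gradient g f x = matrix_inv (g x) *v a"
  unfolding gradient_def partial_deriv_eqI[OF has_derivative_f]
  by (simp add: inner_axis)

lemma metric_gradient: "g x *v gradient g f x = a"
  by (simp add: gradient matrix_vector_mul_assoc matrix_mul_matrix_inv[OF inv])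

lemma gradient_norm_pos: "ginner g x (gradient g f x) (gradient g f x) > 0"
proof -
  have "gradient g f x \<noteq> 0" using metric_gradient[of x] nonzero by auto
  then show ?thesis unfolding ginner_def by (rule pos)
qed

lemma ginner_unit_normal:
  "ginner g x u (unit_normal g f x) =
    (a \<bullet> u) / sqrt (ginner g x (gradient g f x) (gradient g f x))"
  by (simp add: ginner_def unit_normal_def matrix_vector_mult_scaleR metric_gradient inner_commute)

lemma ginner_unit_normal_self: "ginner g x (unit_normal g f x) (unit_normal g f x) = 1"
proof -
  have "a \<bullet> unit_normal g f x = sqrt (ginner g x (gradient g f x) (gradient g f x))"
    using gradient_norm_pos[of x]
    by (simp add: unit_normal_def ginner_def metric_gradient inner_commute real_div_sqrt)
  then show ?thesis using gradient_norm_pos[of x] by (simp add: ginner_unit_normal)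
qed

lemma unit_normal_transversal: "a \<bullet> unit_normal g f x \<noteq> 0"
  using ginner_unit_normal_self[of x] ginner_unit_normal[of x "unit_normal g f x"] by auto

text \<open>The derivative of the unit normal is never computed. Differentiating the identity g(u,
  N) = 0 along \<open>u\<close> expresses it through \<open>D\<close>, and the Koszul formula
  handles the connection term. The inverse metric only has to be differentiable, so that the normal
  is.\<close>

lemma second_fundamental_form_diagonal:
  assumes D: "(g has_derivative D) (at x)"
    and inv_diff: "(\<lambda>y. matrix_inv (g y)) differentiable (at x)"
    and u: "a \<bullet> u = 0"
  shows "second_fundamental_form g f x u u =
    u \<bullet> (D u *v unit_normal g f x) - u \<bullet> (D (unit_normal g f x) *v u) / 2"
proof -
  let ?n = "unit_normal g f"
  have grad: "gradient g f differentiable (at x)"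
    unfolding gradient[abs_def] by (intro differentiable_matrix_vector_mult inv_diff) simp
  have "(\<lambda>y. ginner g y (gradient g f y) (gradient g f y)) differentiable (at x)"
    using differentiable_inner[OF grad differentiable_matrix_vector_mult[OF _ grad]] D
    unfolding ginner_def differentiable_def by blast
  then obtain S' where "((\<lambda>y. ginner g y (gradient g f y) (gradient g f y)) has_derivative S') (at x)"
    by (auto simp: differentiable_def)
  note has_derivative_real_sqrt[OF gradient_norm_pos this]
  then have "(\<lambda>y. sqrt (ginner g y (gradient g f y) (gradient g f y))) differentiable (at x)"
    by (rule differentiableI)
  then have "?n differentiable (at x)"
    using gradient_norm_pos[of x] grad unfolding unit_normal_def[abs_def]
    by (intro differentiable_scaleR differentiable_divide differentiable_const) auto
  then obtain Dn where Dn: "(?n has_derivative Dn) (at x)"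
    by (auto simp: differentiable_def)
  have "((\<lambda>y. u \<bullet> (g y *v ?n y)) has_derivative (\<lambda>d. u \<bullet> (g x *v Dn d + D d *v ?n x))) (at x)"
    by (intro has_derivative_inner_right has_derivative_matrix_vector_mult D Dn)
  \<comment> \<open>The constant vector \<open>u\<close> is orthogonal to the normal at every point,
    not only at \<open>x\<close>, so the derivative found above must vanish.\<close>
  moreover have "(\<lambda>y. u \<bullet> (g y *v ?n y)) = (\<lambda>y. 0)"
    using u ginner_unit_normal[of _ u] by (simp add: ginner_def)
  ultimately have "((\<lambda>y. 0) has_derivative (\<lambda>d. u \<bullet> (g x *v Dn d + D d *v ?n x))) (at x)"
    by simp
  then have "(\<lambda>d. u \<bullet> (g x *v Dn d + D d *v ?n x)) = (\<lambda>d. 0)"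
    by (rule has_derivative_unique[OF _ has_derivative_const])
  then have "u \<bullet> (g x *v Dn u + D u *v ?n x) = 0"
    by (rule fun_cong)
  then have 1: "u \<bullet> (g x *v Dn u) = - (u \<bullet> (D u *v ?n x))"
    by (simp add: inner_add_right)
  have 2: "?n x \<bullet> (D u *v u) = u \<bullet> (D u *v ?n x)"
    by (intro inner_matrix_vector_swap has_derivative_symmetric[OF D sym])
  have "second_fundamental_form g f x u u = - (u \<bullet> (g x *v Dn u)) -
      (?n x \<bullet> (D u *v u) + u \<bullet> (D (?n x) *v u) - u \<bullet> (D u *v ?n x)) / 2"
    unfolding koszul_formula[OF D sym inv, symmetric] second_fundamental_form_def
      covariant_deriv_def frechet_derivative_at[OF Dn, symmetric]
    using inner_matrix_vector_swap[OF sym[of x], of u "Dn u"]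
    by (simp add: ginner_def inner_add_left)
  then show ?thesis using 1 2 by simp
qed

end

section \<open>Bases of the whole space that are orthonormal for the metric\<close>

lemma orthonormal_expansion:
  fixes g :: "real^'n \<Rightarrow> real^'n^'n"
  assumes "finite E" "span E = UNIV"
    and on: "\<And>u v. u \<in> E \<Longrightarrow> v \<in> E \<Longrightarrow> ginner g x u v = (if u = v then 1 else 0)"
  shows "v = (\<Sum>e\<in>E. ginner g x v e *\<^sub>R e)"
proof -
  obtain c where c: "v = (\<Sum>e\<in>E. c e *\<^sub>R e)"
    using span_finite[OF assms(1)] assms(2) by (metis (no_types, lifting) UNIV_I imageE)
  have "ginner g x v f = c f" if "f \<in> E" for f
  proof -
    have "ginner g x v f = (\<Sum>e\<in>E. c e * ginner g x e f)"
      unfolding c ginner_def by (simp add: inner_sum_left)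
    also have "\<dots> = (\<Sum>e\<in>E. if e = f then c e else 0)"
      using on that by (intro sum.cong) auto
    finally show ?thesis using assms(1) that by simp
  qed
  then show ?thesis using c by simp
qed

lemma orthonormal_parseval:
  fixes g :: "real^'n \<Rightarrow> real^'n^'n"
  assumes "finite E" "span E = UNIV"
    and on: "\<And>u v. u \<in> E \<Longrightarrow> v \<in> E \<Longrightarrow> ginner g x u v = (if u = v then 1 else 0)"
    and sym: "transpose (g x) = g x"
  shows "(\<Sum>e\<in>E. ginner g x u e * ginner g x v e) = ginner g x u v"
proof -
  have "ginner g x u v = (\<Sum>e\<in>E. ginner g x u e * ginner g x e v)"
    by (subst (1) orthonormal_expansion[OF assms(1-3), of u]) (simp_all add: ginner_def inner_sum_left)
  then show ?thesis
    using inner_matrix_vector_swap[OF sym] by (simp add: ginner_def)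
qed

lemma orthonormal_card:
  fixes g :: "real^'n \<Rightarrow> real^'n^'n"
  assumes "finite E" "span E = UNIV"
    and on: "\<And>u v. u \<in> E \<Longrightarrow> v \<in> E \<Longrightarrow> ginner g x u v = (if u = v then 1 else 0)"
  shows "card E = CARD('n)"
proof -
  have "c f = 0" if "(\<Sum>e\<in>E. c e *\<^sub>R e) = 0" "f \<in> E" for c f
  proof -
    have "0 = ginner g x (\<Sum>e\<in>E. c e *\<^sub>R e) f"
      using that by (simp add: ginner_def)
    also have "\<dots> = (\<Sum>e\<in>E. c e * ginner g x e f)"
      unfolding ginner_def by (simp add: inner_sum_left)
    also have "\<dots> = (\<Sum>e\<in>E. if e = f then c e else 0)"
      using on that by (intro sum.cong) auto
    finally show ?thesis using assms(1) that by simp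
  qed
  then have "independent E"
    using assms(1) by (auto simp: dependent_finite)
  then have "card E = dim (span E)" by (simp add: dim_eq_card_independent)
  then show ?thesis using assms(2) by simp
qed

lemma has_derivative_componentwise_vec:
  fixes f :: "'a::real_normed_vector \<Rightarrow> ('b::euclidean_space)^'n"
  assumes "\<And>i. ((\<lambda>x. f x $ i) has_derivative (\<lambda>d. f' d $ i)) (at x)"
  shows "(f has_derivative f') (at x)"
proof (subst has_derivative_componentwise_within, intro ballI)
  fix b :: "'b^'n" assume "b \<in> Basis"
  then obtain i u where "b = axis i u" by (auto simp: Basis_vec_def)
  then show "((\<lambda>x. f x \<bullet> b) has_derivative (\<lambda>d. f' d \<bullet> b)) (at x)"
    using has_derivative_inner_left[OF assms] by (simp add: inner_axis)
qed

lemma differentiable_componentwise_vec: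
  fixes f :: "'a::real_normed_vector \<Rightarrow> ('b::euclidean_space)^'n"
  assumes "\<And>i. (\<lambda>x. f x $ i) differentiable (at x)"
  shows "f differentiable (at x)"
proof -
  obtain f' where f': "\<And>i. ((\<lambda>x. f x $ i) has_derivative f' i) (at x)"
    using assms unfolding differentiable_def by metis
  have "(f has_derivative (\<lambda>d. \<chi> i. f' i d)) (at x)"
    by (rule has_derivative_componentwise_vec) (simp add: f')
  then show ?thesis by (rule differentiableI)
qed

lemma inner_matrix_of_bilinear:
  fixes B :: "real^'n \<Rightarrow> real^'n \<Rightarrow> real"
  assumes "bilinear B"
  shows "u \<bullet> ((\<chi> j k. B (axis j 1) (axis k 1)) *v v) = B u v"
proof -
  have "B u v = B (\<Sum>j\<in>UNIV. u $ j *\<^sub>R axis j 1) (\<Sum>k\<in>UNIV. v $ k *\<^sub>R axis k 1)"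
    by (simp add: basis_expansion flip: scalar_mult_eq_scaleR)
  also have "\<dots> = (\<Sum>j\<in>UNIV. \<Sum>k\<in>UNIV. B (axis j 1) (axis k 1) * u $ j * v $ k)"
    by (simp add: bilinear_sum[OF assms] bilinear_lmul[OF assms] bilinear_rmul[OF assms]
        sum.cartesian_product mult_ac)
  finally show ?thesis by (simp add: inner_matrix_vector_sum)
qed

lemma matrix_inv_unique:
  fixes M :: "real^'n^'n"
  assumes "M ** N = mat 1"
  shows "matrix_inv M = N"
proof -
  have "N ** M = mat 1" using assms by (simp add: matrix_left_right_inverse)
  then have "invertible M" using assms by (auto simp: invertible_def)
  then have "matrix_inv M ** M = mat 1"
    unfolding matrix_inv_def invertible_def by (rule someI2_ex) blast
  then show ?thesis
    by (metis assms matrix_mul_assoc matrix_mul_lid matrix_mul_rid)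
qed

section \<open>Metrics built from Killing tensors\<close>

text \<open>With X = (1, x), U = (0, u) and V = (0, v), the first two terms are the inner product of
  the bivectors of (X, U) and (X, V). The last term is the rank-one perturbation.\<close>

definition killing_form :: "(real^'n \<Rightarrow> real^'n) \<Rightarrow> real^'n \<Rightarrow> real^'n \<Rightarrow> real^'n \<Rightarrow> real" where
  "killing_form w x u v = (1 + x \<bullet> x) * (u \<bullet> v) - (x \<bullet> u) * (x \<bullet> v) + (w x \<bullet> u) * (w x \<bullet> v)"

text \<open>For \<open>w\<close> induced by a skew endomorphism \<open>\<Omega>\<close> of \<open>\<real>\<^sup>n\<^sup>+\<^sup>1\<close> this is \<open>|\<Omega> X|\<^sup>2\<close> at \<open>X = (1, x)\<close>: the
  component of \<open>\<Omega> X\<close> along the first coordinate is \<open>- (x \<bullet> w x)\<close> because \<open>\<Omega> X\<close> is orthogonal to \<open>X\<close>.\<close>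

definition bivector_norm :: "(real^'n \<Rightarrow> real^'n) \<Rightarrow> real^'n \<Rightarrow> real" where
  "bivector_norm w x = w x \<bullet> w x + (x \<bullet> w x)\<^sup>2"

text \<open>The base of the power is the determinant of \<open>killing_form w x\<close>.\<close>

definition conformal_factor :: "(real^'n \<Rightarrow> real^'n) \<Rightarrow> real^'n \<Rightarrow> real" where
  "conformal_factor w x =
     ((1 + x \<bullet> x) ^ (CARD('n) - 2) * (1 + x \<bullet> x + bivector_norm w x)) powr (- 2 / (real CARD('n) - 1))"

definition killing_metric :: "(real^'n \<Rightarrow> real^'n) \<Rightarrow> real^'n \<Rightarrow> real^'n^'n" where
  "killing_metric w x =
     (\<chi> j k. conformal_factor w x * killing_form w x (axis j 1) (axis k 1))"

lemma bilinear_killing_form: "bilinear (killing_form w x)"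
  by (simp add: bilinear_def linear_iff killing_form_def algebra_simps)

lemma inner_killing_metric:
  "u \<bullet> (killing_metric w x *v v) = conformal_factor w x * killing_form w x u v"
proof -
  have "bilinear (\<lambda>u v. conformal_factor w x * killing_form w x u v)"
    using bilinear_killing_form[of w x] by (simp add: bilinear_def linear_iff algebra_simps)
  from inner_matrix_of_bilinear[OF this] show ?thesis by (simp add: killing_metric_def)
qed

lemma bivector_norm_nonneg: "bivector_norm w x \<ge> 0"
  by (simp add: bivector_norm_def)

lemma one_plus_inner_pos: "1 + x \<bullet> (x::'a::real_inner) > 0"
  by (simp add: add_pos_nonneg)

lemma bivector_sum_pos: "1 + x \<bullet> x + bivector_norm w x > 0"
  by (simp add: add_pos_nonneg bivector_norm_nonneg one_plus_inner_pos)

lemma conformal_base_pos: "(1 + x \<bullet> x) ^ m * (1 + x \<bullet> x + bivector_norm w x) > 0"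
  by (simp add: bivector_sum_pos one_plus_inner_pos)

lemma conformal_factor_pos: "conformal_factor w (x::real^'n) > 0"
  using conformal_base_pos[of x "CARD('n) - 2" w] unfolding conformal_factor_def powr_gt_zero by linarith

lemma killing_form_commute: "killing_form w x u v = killing_form w x v u"
  by (simp add: killing_form_def inner_commute)

lemma transpose_killing_metric: "transpose (killing_metric w x) = killing_metric w x"
  by (simp add: vec_eq_iff transpose_def killing_metric_def killing_form_commute)

lemma killing_form_pos:
  assumes "v \<noteq> 0"
  shows "killing_form w x v v > 0"
proof -
  have "(x \<bullet> v)\<^sup>2 \<le> (x \<bullet> x) * (v \<bullet> v)" by (rule Cauchy_Schwarz_ineq)
  moreover have "v \<bullet> v > 0" using assms by simp
  moreover have "killing_form w x v v = v \<bullet> v + ((x \<bullet> x) * (v \<bullet> v) - (x \<bullet> v)\<^sup>2) + (w x \<bullet> v)\<^sup>2"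
    by (simp add: killing_form_def algebra_simps power2_eq_square)
  ultimately show ?thesis by (smt (verit) zero_le_power2)
qed

lemma killing_metric_pos: "v \<noteq> 0 \<Longrightarrow> v \<bullet> (killing_metric w x *v v) > 0"
  by (simp add: inner_killing_metric conformal_factor_pos killing_form_pos)

text \<open>The inverse of the metric applied to \<open>p\<close>: the Sherman-Morrison formula for
  \<open>(1 + |x|\<^sup>2) I - x x\<^sup>T + w w\<^sup>T\<close>.\<close>

definition dual_vector :: "(real^'n \<Rightarrow> real^'n) \<Rightarrow> real^'n \<Rightarrow> real^'n \<Rightarrow> real^'n" where
  "dual_vector w x p = (1 / (conformal_factor w x * (1 + x \<bullet> x))) *\<^sub>R
     (p + (x \<bullet> p) *\<^sub>R x -
      (((w x + (x \<bullet> w x) *\<^sub>R x) \<bullet> p) / (1 + x \<bullet> x + bivector_norm w x)) *\<^sub>R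
        (w x + (x \<bullet> w x) *\<^sub>R x))"

lemma killing_metric_dual_vector: "killing_metric w x *v dual_vector w x p = p"
proof -
  define r where "r = 1 + x \<bullet> x"
  define q where "q = bivector_norm w x"
  define t where "t = x \<bullet> w x"
  \<comment> \<open>\<open>h / r\<close> is the inverse of the unperturbed form r I - x x^T applied
    to \<open>w x\<close>. The pairing w . h = q then produces the Sherman-Morrison denominator 1 +
    q / r, up to the factor \<open>r\<close>.\<close>
  define h where "h = w x + t *\<^sub>R x"
  define c where "c = (h \<bullet> p) / (r + q)"
  define p' where "p' = p + (x \<bullet> p) *\<^sub>R x - c *\<^sub>R h"
  have rq: "r > 0" "r + q > 0"
    unfolding r_def q_def by (rule one_plus_inner_pos bivector_sum_pos)+
  have xx: "x \<bullet> x = r - 1" by (simp add: r_def)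
  have ww: "w x \<bullet> w x = q - t\<^sup>2" by (simp add: q_def t_def bivector_norm_def)
  have wh: "w x \<bullet> h = q" by (simp add: h_def inner_add_right ww inner_commute[of _ x] flip: t_def) (simp add: power2_eq_square)
  have xh: "x \<bullet> h = t * r" by (simp add: h_def inner_add_right xx algebra_simps flip: t_def)
  have c: "h \<bullet> p = c * (r + q)" using rq by (simp add: c_def)
  have wp: "w x \<bullet> p' = c * r"
    using c by (simp add: p'_def inner_diff_right inner_add_right wh inner_commute[of _ x] flip: t_def)
      (simp add: h_def inner_add_left algebra_simps)
  have xp: "x \<bullet> p' = r * (x \<bullet> p) - c * t * r"
    by (simp add: p'_def inner_diff_right inner_add_right xh xx algebra_simps)
  have "killing_form w x u p' = r * (u \<bullet> p)" for u
    unfolding killing_form_def wp xp r_def[symmetric]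
    by (simp add: p'_def h_def inner_diff_right inner_add_right inner_add_left algebra_simps
        inner_commute[of u])
  moreover have "dual_vector w x p = (1 / (conformal_factor w x * r)) *\<^sub>R p'"
    by (simp add: dual_vector_def p'_def c_def h_def t_def q_def r_def)
  ultimately have "u \<bullet> (killing_metric w x *v dual_vector w x p) = u \<bullet> p" for u
    using rq conformal_factor_pos[of w x]
    by (simp add: matrix_vector_mult_scaleR inner_killing_metric)
  then show ?thesis using vector_eq_ldot by blast
qed

lemma matrix_inv_killing_metric:
  "matrix_inv (killing_metric w x) = (\<chi> j k. dual_vector w x (axis k 1) $ j)"
proof (rule matrix_inv_unique)
  have "(killing_metric w x ** (\<chi> j k. dual_vector w x (axis k 1) $ j)) $ i $ k =
      (killing_metric w x *v dual_vector w x (axis k 1)) $ i" for i k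
    by (simp add: matrix_matrix_mult_def matrix_vector_mult_def)
  then show "killing_metric w x ** (\<chi> j k. dual_vector w x (axis k 1) $ j) = mat 1"
    by (simp add: killing_metric_dual_vector vec_eq_iff mat_def axis_def)
qed

text \<open>An affine field with skew linear part is an infinitesimal Euclidean isometry. The
  derivative of w . u along \<open>u\<close> is \<open>A u \<bullet> u\<close>, which vanishes, so
  the square of the covector \<open>w\<close> satisfies the Killing equation.\<close>

locale killing_field =
  fixes w A :: "real^'n \<Rightarrow> real^'n"
  assumes affine: "w x = w 0 + A x"
    and linear: "linear A"
    and skew: "A u \<bullet> v = - (A v \<bullet> u)"
begin

lemma bounded_linear: "bounded_linear A"
  using linear by (simp add: linear_conv_bounded_linear)

lemma has_derivative_field: "(w has_derivative A) (at x)"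
proof -
  have "w = (\<lambda>x. w 0 + A x)" using affine by blast
  moreover have "((\<lambda>x. w 0 + A x) has_derivative A) (at x)"
    by (auto intro!: derivative_eq_intros bounded_linear_imp_has_derivative[OF bounded_linear])
  ultimately show ?thesis by simp
qed

definition bivector_norm_deriv :: "real^'n \<Rightarrow> real^'n \<Rightarrow> real" where
  "bivector_norm_deriv x d = 2 * (w x \<bullet> A d) + 2 * (x \<bullet> w x) * (d \<bullet> w x + x \<bullet> A d)"

text \<open>The logarithmic derivative of \<open>conformal_factor\<close>; using it keeps the
  conformal factor as an overall factor of \<open>metric_deriv\<close>.\<close>

definition log_factor_deriv :: "real^'n \<Rightarrow> real^'n \<Rightarrow> real" where
  "log_factor_deriv x d = - 2 / (real CARD('n) - 1) *
     (real (CARD('n) - 2) * (2 * (x \<bullet> d)) / (1 + x \<bullet> x) +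
      (2 * (x \<bullet> d) + bivector_norm_deriv x d) / (1 + x \<bullet> x + bivector_norm w x))"

definition killing_form_deriv :: "real^'n \<Rightarrow> real^'n \<Rightarrow> real^'n \<Rightarrow> real^'n \<Rightarrow> real" where
  "killing_form_deriv x d u v = 2 * (x \<bullet> d) * (u \<bullet> v) - (d \<bullet> u) * (x \<bullet> v) - (x \<bullet> u) * (d \<bullet> v)
     + (A d \<bullet> u) * (w x \<bullet> v) + (w x \<bullet> u) * (A d \<bullet> v)"

definition metric_deriv :: "real^'n \<Rightarrow> real^'n \<Rightarrow> real^'n^'n" where
  "metric_deriv x d = (\<chi> j k. conformal_factor w x *
     (log_factor_deriv x d * killing_form w x (axis j 1) (axis k 1) +
      killing_form_deriv x d (axis j 1) (axis k 1)))"

lemma has_derivative_bivector_norm: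
  "(bivector_norm w has_derivative bivector_norm_deriv x) (at x)"
  unfolding bivector_norm_def[abs_def] bivector_norm_deriv_def[abs_def]
  by (auto intro!: derivative_eq_intros has_derivative_field simp: algebra_simps inner_commute)

lemma has_derivative_killing_form:
  "((\<lambda>y. killing_form w y u v) has_derivative (\<lambda>d. killing_form_deriv x d u v)) (at x)"
  unfolding killing_form_def[abs_def] killing_form_deriv_def[abs_def]
  by (auto intro!: derivative_eq_intros has_derivative_field simp: algebra_simps inner_commute)

lemma has_derivative_conformal_factor:
  "(conformal_factor w has_derivative (\<lambda>d. conformal_factor w x * log_factor_deriv x d)) (at x)"
proof -
  define m where "m = CARD('n) - 2"
  define b where "b = (\<lambda>y::real^'n. (1 + y \<bullet> y) ^ m * (1 + y \<bullet> y + bivector_norm w y))"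
  define c where "c = - 2 / (real CARD('n) - 1)"
  have r: "1 + x \<bullet> x > 0" by (rule one_plus_inner_pos)
  have rq: "1 + x \<bullet> x + bivector_norm w x > 0" by (rule bivector_sum_pos)
  \<comment> \<open>The factor \<open>real m\<close> makes both sides vanish at
    \<open>m = 0\<close>, where the exponent \<open>m - 1\<close> is truncated.\<close>
  have pw: "real m * (1 + x \<bullet> x) ^ (m - 1) = real m * (1 + x \<bullet> x) ^ m / (1 + x \<bullet> x)"
    using r by (cases m) auto
  have "(b has_derivative (\<lambda>d. b x * (real m * (2 * (x \<bullet> d)) / (1 + x \<bullet> x) +
      (2 * (x \<bullet> d) + bivector_norm_deriv x d) / (1 + x \<bullet> x + bivector_norm w x)))) (at x)"
  proof -
    have "((\<lambda>y::real^'n. (1 + y \<bullet> y) ^ m) has_derivative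
        (\<lambda>d. real m * (1 + x \<bullet> x) ^ (m - 1) * (2 * (x \<bullet> d)))) (at x)"
      by (auto intro!: derivative_eq_intros simp: inner_commute)
    then have 1: "((\<lambda>y::real^'n. (1 + y \<bullet> y) ^ m) has_derivative
        (\<lambda>d. real m * (1 + x \<bullet> x) ^ m / (1 + x \<bullet> x) * (2 * (x \<bullet> d)))) (at x)"
      unfolding pw .
    have 2: "((\<lambda>y. 1 + y \<bullet> y + bivector_norm w y) has_derivative
        (\<lambda>d. 2 * (x \<bullet> d) + bivector_norm_deriv x d)) (at x)"
      by (auto intro!: derivative_eq_intros has_derivative_bivector_norm simp: inner_commute)
    have "p * s' + k * p / r * t * s = p * s * (k * t / r + s' / s)"
      if "r > 0" "s > 0" for p s' k r t s :: real
      using that by (simp add: field_simps)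
    note alg = this[OF r rq]
    show ?thesis unfolding b_def
      by (rule has_derivative_eq_rhs[OF has_derivative_mult[OF 1 2]]) (simp only: alg)
  qed
  moreover have "b x > 0" unfolding b_def by (rule conformal_base_pos)
  ultimately have "((\<lambda>y. b y powr c) has_derivative (\<lambda>d. b x powr c * (c * (real m * (2 * (x \<bullet> d)) / (1 + x \<bullet> x) +
      (2 * (x \<bullet> d) + bivector_norm_deriv x d) / (1 + x \<bullet> x + bivector_norm w x))))) (at x)"
    by (auto intro!: derivative_eq_intros)
  moreover have "conformal_factor w = (\<lambda>y. b y powr c)"
    by (simp add: fun_eq_iff conformal_factor_def b_def c_def m_def)
  ultimately show ?thesis
    by (simp add: log_factor_deriv_def c_def m_def)
qed

lemma has_derivative_killing_metric:
  "(killing_metric w has_derivative metric_deriv x) (at x)"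
proof (intro has_derivative_componentwise_vec)
  fix j k :: 'n
  let ?e = "axis j 1 :: real^'n" and ?f = "axis k 1 :: real^'n"
  show "((\<lambda>x. killing_metric w x $ j $ k) has_derivative (\<lambda>d. metric_deriv x d $ j $ k)) (at x)"
    unfolding killing_metric_def metric_deriv_def vec_lambda_beta
    by (rule has_derivative_eq_rhs[OF has_derivative_mult[OF has_derivative_conformal_factor
          has_derivative_killing_form]]) (simp add: fun_eq_iff algebra_simps)
qed

lemma inner_metric_deriv:
  "u \<bullet> (metric_deriv x d *v v) = conformal_factor w x *
     (log_factor_deriv x d * killing_form w x u v + killing_form_deriv x d u v)"
proof -
  have "bilinear (\<lambda>u v. conformal_factor w x *
      (log_factor_deriv x d * killing_form w x u v + killing_form_deriv x d u v))"
    by (simp add: bilinear_def linear_iff killing_form_def killing_form_deriv_def algebra_simps)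
  from inner_matrix_of_bilinear[OF this] show ?thesis by (simp add: metric_deriv_def)
qed

text \<open>This is the symmetrised derivative on (u, u, d) set to zero. In the perturbation term,
  skewness kills \<open>A u \<bullet> u\<close> and exchanges \<open>A u \<bullet> d\<close> with
  \<open>- (A d \<bullet> u)\<close>; the round terms match identically.\<close>

lemma killing_equation:
  "killing_form_deriv x d u u = - 2 * killing_form_deriv x u u d"
  using skew[of u u] skew[of d u]
  by (simp add: killing_form_deriv_def inner_commute algebra_simps)

lemma differentiable_dual_vector: "(\<lambda>y. dual_vector w y p) differentiable (at x)"
proof -
  have d: "w differentiable (at x)" "bivector_norm w differentiable (at x)"
      "conformal_factor w differentiable (at x)"
    using has_derivative_field has_derivative_bivector_norm has_derivative_conformal_factor
    by (blast intro: differentiableI)+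
  show ?thesis
    unfolding dual_vector_def
    using one_plus_inner_pos[of x] bivector_sum_pos[of x w] conformal_factor_pos[of w x] d
    by (intro differentiable_scaleR differentiable_divide differentiable_diff differentiable_add
        differentiable_inner differentiable_mult differentiable_const differentiable_ident) auto
qed

lemma differentiable_matrix_inv_killing_metric:
  "(\<lambda>y. matrix_inv (killing_metric w y)) differentiable (at x)"
  unfolding matrix_inv_killing_metric
  by (intro differentiable_componentwise_vec)
    (auto intro: differentiable_compose[OF bounded_linear_imp_differentiable[OF bounded_linear_vec_nth] differentiable_dual_vector])

end

text \<open>Parseval for covectors: \<open>dual_vector\<close> raises the index, so the right-hand
  side is the inverse metric evaluated on \<open>p\<close> and \<open>q\<close>.\<close>

lemma orthonormal_dual_sum:
  assumes E: "finite E" "span E = UNIV"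
    "\<And>u v. u \<in> E \<Longrightarrow> v \<in> E \<Longrightarrow> ginner (killing_metric w) x u v = (if u = v then 1 else 0)"
  shows "(\<Sum>e\<in>E. (p \<bullet> e) * (q \<bullet> e)) = p \<bullet> dual_vector w x q"
proof -
  have dual: "ginner (killing_metric w) x (dual_vector w x p) v = p \<bullet> v" for p v
    using inner_matrix_vector_swap[OF transpose_killing_metric]
    by (metis ginner_def inner_commute killing_metric_dual_vector)
  show ?thesis
    using orthonormal_parseval[OF E transpose_killing_metric, of "dual_vector w x p" "dual_vector w x q"]
    by (simp add: dual)
qed

text \<open>Jacobi's formula tr(K^-1 D_d K) = d (log det K), written through
  \<open>log_factor_deriv\<close>, which is - 2 / (n - 1) times the right-hand side. The factor
  \<open>conformal_factor w x\<close> converts the trace over a basis orthonormal for g into the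
  trace with respect to K.\<close>

lemma (in killing_field) killing_form_deriv_trace:
  assumes E: "finite E" "span E = UNIV"
    "\<And>u v. u \<in> E \<Longrightarrow> v \<in> E \<Longrightarrow> ginner (killing_metric w) x u v = (if u = v then 1 else 0)"
    and n: "CARD('n) \<ge> 2"
  shows "conformal_factor w x * (\<Sum>e\<in>E. killing_form_deriv x d e e) =
    - (real CARD('n) - 1) / 2 * log_factor_deriv x d"
proof -
  define c where "c = conformal_factor w x"
  define r where "r = 1 + x \<bullet> x"
  define q where "q = bivector_norm w x"
  define t where "t = x \<bullet> w x"
  define h where "h = w x + t *\<^sub>R x"
  define s where "s = r + q"
  have pos: "c > 0" "r > 0" "s > 0"
    unfolding c_def r_def q_def s_def
    by (rule conformal_factor_pos one_plus_inner_pos bivector_sum_pos)+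
  have q: "q = s - r" by (simp add: s_def)
  have xx: "x \<bullet> x = r - 1" by (simp add: r_def)
  have ww: "w x \<bullet> w x = q - t\<^sup>2" by (simp add: q_def t_def bivector_norm_def)
  have wx: "w x \<bullet> x = t" by (simp add: t_def inner_commute)
  have hx: "h \<bullet> x = t * r"
    by (simp add: h_def inner_add_left xx wx algebra_simps)
  have hw: "h \<bullet> w x = q"
    by (simp add: h_def inner_add_left ww power2_eq_square flip: t_def)
  have hh: "h \<bullet> h = q + t\<^sup>2 * r"
    by (subst (2) h_def) (simp add: inner_add_right hw hx power2_eq_square)
  \<comment> \<open>Multiplying by \<open>c * r * s\<close> clears all denominators, so the three
    sums below become polynomial in the pairings with \<open>x\<close> and \<open>h\<close>.\<close>
  have dual: "c * r * s * (p \<bullet> dual_vector w x v) =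
      s * (p \<bullet> v) + s * (x \<bullet> v) * (x \<bullet> p) - (h \<bullet> v) * (h \<bullet> p)" for p v
  proof -
    have "dual_vector w x v = (1 / (c * r)) *\<^sub>R (v + (x \<bullet> v) *\<^sub>R x - ((h \<bullet> v) / s) *\<^sub>R h)"
      by (simp add: dual_vector_def c_def r_def q_def t_def h_def s_def)
    then have "p \<bullet> dual_vector w x v =
        (1 / (c * r)) * ((p \<bullet> v) + (x \<bullet> v) * (x \<bullet> p) - (h \<bullet> v) / s * (h \<bullet> p))"
      by (simp add: inner_diff_right inner_add_right inner_commute[of p h] inner_commute[of p x])
    then show ?thesis using pos by (simp add: field_simps)
  qed
  have S: "(\<Sum>e\<in>E. (p \<bullet> e) * (q \<bullet> e)) = p \<bullet> dual_vector w x q" for p q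
    using E by (rule orthonormal_dual_sum)
  \<comment> \<open>The basis is not Euclidean-orthonormal, so the squared Euclidean lengths are
    split into coordinate covectors to which \<open>S\<close> applies.\<close>
  have "(\<Sum>e\<in>E. e \<bullet> e) = (\<Sum>e\<in>E. \<Sum>j\<in>UNIV. (axis j 1 \<bullet> e) * (axis j 1 \<bullet> e))"
    by (simp add: inner_vec_def axis_def if_distrib[of "\<lambda>z. z * _"] cong: if_cong)
  also have "\<dots> = (\<Sum>j\<in>UNIV. axis j 1 \<bullet> dual_vector w x (axis j 1))"
    by (subst sum.swap) (simp add: S)
  finally have "c * r * s * (\<Sum>e\<in>E. e \<bullet> e) =
      (\<Sum>j\<in>(UNIV::'n set). c * r * s * (axis j 1 \<bullet> dual_vector w x (axis j 1)))"
    by (simp only: sum_distrib_left)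
  also have "\<dots> = (\<Sum>j\<in>(UNIV::'n set). s + s * (x $ j * x $ j) - h $ j * h $ j)"
    unfolding dual by (simp add: inner_axis mult_ac)
  also have "\<dots> = real CARD('n) * s + s * (x \<bullet> x) - h \<bullet> h"
    by (simp add: sum.distrib sum_subtractf inner_vec_def sum_distrib_left)
  finally have 1: "c * r * s * (\<Sum>e\<in>E. e \<bullet> e) = real CARD('n) * s + s * (r - 1) - (q + t\<^sup>2 * r)"
    by (simp add: xx hh)
  have 2: "c * r * s * (\<Sum>e\<in>E. (d \<bullet> e) * (x \<bullet> e)) = s * r * (x \<bullet> d) - t * r * (h \<bullet> d)"
    unfolding S[of d x] dual[of d x]
    by (simp only: xx hx inner_commute[of d x] inner_commute[of d h]) (simp add: algebra_simps)
  have 3: "c * r * s * (\<Sum>e\<in>E. (A d \<bullet> e) * (w x \<bullet> e)) = r * (h \<bullet> A d)"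
    unfolding S dual hw
    by (simp add: h_def q inner_add_left algebra_simps inner_commute[of "A d"] flip: t_def)
  have sum_eq: "(\<Sum>e\<in>E. killing_form_deriv x d e e) = 2 * (x \<bullet> d) * (\<Sum>e\<in>E. e \<bullet> e)
      - 2 * (\<Sum>e\<in>E. (d \<bullet> e) * (x \<bullet> e)) + 2 * (\<Sum>e\<in>E. (A d \<bullet> e) * (w x \<bullet> e))"
    by (simp add: killing_form_deriv_def sum.distrib sum_subtractf sum_distrib_left algebra_simps)
  have "r * s * (c * (\<Sum>e\<in>E. killing_form_deriv x d e e)) =
      2 * (x \<bullet> d) * (c * r * s * (\<Sum>e\<in>E. e \<bullet> e))
      - 2 * (c * r * s * (\<Sum>e\<in>E. (d \<bullet> e) * (x \<bullet> e)))
      + 2 * (c * r * s * (\<Sum>e\<in>E. (A d \<bullet> e) * (w x \<bullet> e)))"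
    unfolding sum_eq by (simp only: distrib_left right_diff_distrib mult_ac)
  also have "\<dots> = 2 * (x \<bullet> d) * (real CARD('n) * s + s * (r - 1) - (q + t\<^sup>2 * r))
      - 2 * (s * r * (x \<bullet> d) - t * r * (h \<bullet> d)) + 2 * (r * (h \<bullet> A d))"
    unfolding 1 2 3 ..
  also have "\<dots> = (real CARD('n) - 2) * (2 * (x \<bullet> d)) * s +
      (2 * (x \<bullet> d) + bivector_norm_deriv x d) * r"
    by (simp add: bivector_norm_deriv_def h_def q inner_add_left inner_commute[of d]
        power2_eq_square algebra_simps flip: t_def)
  also have "\<dots> = r * s * (- (real CARD('n) - 1) / 2 * log_factor_deriv x d)"
    using pos n unfolding log_factor_deriv_def r_def[symmetric] q_def[symmetric] s_def[symmetric]
    by (simp add: of_nat_diff field_simps)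
  finally show ?thesis using pos by (simp add: c_def)
qed

text \<open>Writing \<open>K\<close> for the Killing tensor and \<open>\<phi>\<close> for the conformal factor, the Killing equation
  reduces the trace of the second fundamental form to
  \<open>- (n - 1) / 2 * d (log \<phi>) (N) - tr\<^sub>K (D\<^sub>N K)\<close>, and \<open>tr\<^sub>K (D\<^sub>N K) = d (log (det K)) (N)\<close>.\<close>

lemma (in killing_field) zero_mean_curvature_affine:
  assumes n: "CARD('n) \<ge> 2" and a: "a \<noteq> 0" and f: "\<And>x. f x = a \<bullet> x + b"
  shows "zero_mean_curvature_at (killing_metric w) f x"
proof -
  interpret affine_level_sets "killing_metric w" a b f
    using transpose_killing_metric killing_metric_pos a f by unfold_locales
  let ?g = "killing_metric w" and ?N = "unit_normal (killing_metric w) f x"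
  let ?c = "conformal_factor w x"
  show ?thesis unfolding zero_mean_curvature_at_def
  proof (intro allI impI)
    fix E assume "orthonormal_basis_of ?g x (level_tangent f x) E"
    then have fin: "finite E" and span: "span E = {u. a \<bullet> u = 0}"
      and on: "\<And>u v. u \<in> E \<Longrightarrow> v \<in> E \<Longrightarrow> ginner ?g x u v = (if u = v then 1 else 0)"
      unfolding orthonormal_basis_of_def level_tangent by auto
    have tan: "a \<bullet> e = 0" if "e \<in> E" for e
      using span span_base[OF that] by auto
    have orth: "ginner ?g x e ?N = 0" "ginner ?g x ?N e = 0" if "e \<in> E" for e
      using ginner_unit_normal[of x e] tan[OF that] inner_matrix_vector_swap[OF sym, of e x ?N]
      by (auto simp: ginner_def)
    \<comment> \<open>Adjoining the unit normal yields an orthonormal basis of the whole space,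
      where the trace formula is available.\<close>
    have notin: "?N \<notin> E" using tan unit_normal_transversal by blast
    have "v \<in> span (insert ?N E)" for v
    proof -
      have "v - ((a \<bullet> v) / (a \<bullet> ?N)) *\<^sub>R ?N \<in> span E"
        unfolding span using unit_normal_transversal[of x] by (simp add: inner_diff_right)
      then show ?thesis using span_breakdown_eq by blast
    qed
    then have span': "span (insert ?N E) = UNIV" by blast
    have on': "ginner ?g x u v = (if u = v then 1 else 0)"
      if "u \<in> insert ?N E" "v \<in> insert ?N E" for u v
      using that on orth ginner_unit_normal_self notin by auto
    have card: "real (card E) = real CARD('n) - 1"
      using orthonormal_card[OF _ span' on'] fin notin by simp
    have II: "second_fundamental_form ?g f x e e =
        - log_factor_deriv x ?N / 2 - ?c * killing_form_deriv x ?N e e" if e: "e \<in> E" for e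
    proof -
      \<comment> \<open>Orthogonality to the normal removes the derivative of the conformal factor
        along \<open>e\<close>; normalisation leaves its derivative along the normal with
        coefficient one.\<close>
      have "?c * killing_form w x e e = 1" "?c * killing_form w x e ?N = 0"
        using on[OF e e] orth(1)[OF e] by (simp_all add: ginner_def inner_killing_metric)
      then have "e \<bullet> (metric_deriv x e *v ?N) = ?c * killing_form_deriv x e e ?N"
        "e \<bullet> (metric_deriv x ?N *v e) = log_factor_deriv x ?N + ?c * killing_form_deriv x ?N e e"
        unfolding inner_metric_deriv by (simp_all only: distrib_left mult.left_commute[of ?c])
      then show ?thesis
        unfolding second_fundamental_form_diagonal[OF has_derivative_killing_metric
            differentiable_matrix_inv_killing_metric tan[OF e]]
        by (simp add: killing_equation[of x ?N e] field_simps)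
    qed
    \<comment> \<open>The Killing equation with all arguments equal reads z = - 2 z. Hence the
      normal direction adds nothing to the trace.\<close>
    have "killing_form_deriv x ?N ?N ?N = 0"
      using killing_equation[of x ?N ?N] by simp
    then have "?c * (\<Sum>e\<in>E. killing_form_deriv x ?N e e) =
        ?c * (\<Sum>e\<in>insert ?N E. killing_form_deriv x ?N e e)"
      using fin notin by simp
    also have "\<dots> = - (real CARD('n) - 1) / 2 * log_factor_deriv x ?N"
      by (rule killing_form_deriv_trace[OF _ span' on' n]) (use fin in auto)
    finally have trace: "?c * (\<Sum>e\<in>E. killing_form_deriv x ?N e e) =
        - (real CARD('n) - 1) / 2 * log_factor_deriv x ?N" .
    have "(\<Sum>e\<in>E. second_fundamental_form ?g f x e e) =
        real (card E) * (- log_factor_deriv x ?N / 2) - ?c * (\<Sum>e\<in>E. killing_form_deriv x ?N e e)"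
      by (simp add: II sum_subtractf sum_distrib_left)
    then show "(\<Sum>e\<in>E. second_fundamental_form ?g f x e e) = 0"
      unfolding trace card by (simp add: field_simps)
  qed
qed

section \<open>Curvature at the origin of a chart\<close>

text \<open>A point where the metric is Euclidean to first order. \<open>H i j l d\<close> is the
  derivative along \<open>d\<close> of the i-th partial derivative of the entry (j, l), so curvature
  at \<open>x\<close> is linear in \<open>H\<close>.\<close>

locale metric_jet =
  fixes g :: "real^'n \<Rightarrow> real^'n^'n" and D and x and H
  assumes D: "(g has_derivative D y) (at y)"
    and inv_diff: "(\<lambda>y. matrix_inv (g y)) differentiable (at x)"
    and gx: "g x = mat 1"
    and Dx: "D x d = 0"
    and H: "((\<lambda>y. D y (axis i 1) $ j $ l) has_derivative H i j l) (at x)"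
begin

lemma christoffel_eq:
  "christoffel g k i j y = 1/2 * (\<Sum>l\<in>UNIV. matrix_inv (g y) $ k $ l *
     (D y (axis i 1) $ j $ l + D y (axis j 1) $ i $ l - D y (axis l 1) $ i $ j))"
  unfolding christoffel_def partial_deriv_eqI[OF has_derivative_entry[OF D]] ..

lemma christoffel_zero: "christoffel g k i j x = 0"
  by (simp add: christoffel_eq Dx)

text \<open>The derivative of the inverse metric is multiplied by first derivatives of
  \<open>g\<close>, which vanish at \<open>x\<close>; its value is therefore irrelevant.\<close>

lemma partial_deriv_christoffel:
  "partial_deriv (christoffel g k i j) m x =
     (H i j k (axis m 1) + H j i k (axis m 1) - H k i j (axis m 1)) / 2"
proof -
  obtain h where h: "((\<lambda>y. matrix_inv (g y)) has_derivative h) (at x)"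
    using inv_diff by (auto simp: differentiable_def)
  have hx: "matrix_inv (g x) = mat 1"
    by (simp add: gx matrix_inv_unique)
  have "((\<lambda>y. matrix_inv (g y) $ k $ l *
      (D y (axis i 1) $ j $ l + D y (axis j 1) $ i $ l - D y (axis l 1) $ i $ j)) has_derivative
      (\<lambda>d. matrix_inv (g x) $ k $ l * (H i j l d + H j i l d - H l i j d) + h d $ k $ l * 0)) (at x)" for l
    by (rule has_derivative_eq_rhs[OF has_derivative_mult[OF has_derivative_entry[OF h]
          has_derivative_diff[OF has_derivative_add[OF H H] H]]]) (simp add: Dx)
  then have "(christoffel g k i j has_derivative (\<lambda>d. 1/2 * (\<Sum>l\<in>UNIV. matrix_inv (g x) $ k $ l *
      (H i j l d + H j i l d - H l i j d) + h d $ k $ l * 0))) (at x)"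
    unfolding christoffel_eq[abs_def] by (intro has_derivative_mult_right has_derivative_sum)
  from partial_deriv_eqI[OF this] show ?thesis
    by (simp add: hx mat_def if_distrib[of "\<lambda>z. z * _"] cong: if_cong)
qed

lemma sectional_curvature_axes:
  assumes "a \<noteq> b"
  shows "sectional_curvature g x (axis a 1) (axis b 1) =
    H b b a (axis a 1) - H a b b (axis a 1) / 2
      - (H a b a (axis b 1) + H b a a (axis b 1) - H a a b (axis b 1)) / 2"
proof -
  have "riemann_tensor g x (axis a 1) (axis b 1) (axis b 1) $ a =
      partial_deriv (christoffel g a b b) a x - partial_deriv (christoffel g a a b) b x"
    by (simp add: riemann_tensor_def christoffel_zero axis_def if_distrib[of "\<lambda>z. _ * z"] cong: if_cong)
  moreover have "axis a (1::real) $ b = 0" using assms by (simp add: axis_def)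
  ultimately show ?thesis
    using assms
    by (simp add: sectional_curvature_def ginner_def gx inner_axis inner_axis_axis
        partial_deriv_christoffel field_simps)
qed

end

text \<open>A zero of the field at the origin makes the metric Euclidean there to first order. The
  three summands come from the round metric, from the square of the covector \<open>w\<close>, and
  from the change that \<open>w\<close> causes in the conformal factor.\<close>

lemma (in killing_field) sectional_curvature_origin:
  assumes w0: "w 0 = 0" and n: "CARD('n) \<ge> 2" and "a \<noteq> b"
  shows "sectional_curvature (killing_metric w) 0 (axis a 1) (axis b 1) =
    1 - 3 * (A (axis a 1) \<bullet> axis b 1)\<^sup>2 +
    2 / (real CARD('n) - 1) * (A (axis a 1) \<bullet> A (axis a 1) + A (axis b 1) \<bullet> A (axis b 1))"
proof -
  \<comment> \<open>The first product is the Hessian of the logarithm of the conformal factor times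
    the identity; the rest is the second derivative of \<open>killing_form\<close>. Cross terms
    vanish because all first derivatives do.\<close>
  define H where "H i j l d =
    - 4 / (real CARD('n) - 1) * ((real CARD('n) - 1) * (d \<bullet> axis i 1) + A d \<bullet> A (axis i 1)) *
      (axis j (1::real) \<bullet> axis l 1) +
    (2 * (d \<bullet> axis i 1) * (axis j (1::real) \<bullet> axis l 1) - (axis i (1::real) \<bullet> axis j 1) * (d \<bullet> axis l 1)
      - (d \<bullet> axis j 1) * (axis i (1::real) \<bullet> axis l 1)
      + (A (axis i 1) \<bullet> axis j 1) * (A d \<bullet> axis l 1) + (A d \<bullet> axis j 1) * (A (axis i 1) \<bullet> axis l 1))"
    for i j l :: 'n and d :: "real^'n"
  have c0: "conformal_factor w 0 = 1"
    by (simp add: conformal_factor_def bivector_norm_def w0)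
  have k0: "killing_form w 0 u v = u \<bullet> v" for u v
    by (simp add: killing_form_def w0)
  have q0: "bivector_norm w 0 = 0"
    by (simp add: bivector_norm_def w0)
  have kd0: "killing_form_deriv 0 d u v = 0" for d u v
    by (simp add: killing_form_deriv_def w0)
  have bd0: "bivector_norm_deriv 0 d = 0" for d
    by (simp add: bivector_norm_deriv_def w0)
  have ld0: "log_factor_deriv 0 d = 0" for d
    by (simp add: log_factor_deriv_def bd0)
  have bd: "((\<lambda>y. bivector_norm_deriv y e) has_derivative (\<lambda>d. 2 * (A d \<bullet> A e))) (at 0)" for e
    unfolding bivector_norm_deriv_def
    by (rule has_derivative_eq_rhs, (rule derivative_intros has_derivative_field)+) (simp add: w0)
  have kd: "((\<lambda>y. killing_form_deriv y e u v) has_derivative (\<lambda>d. 2 * (d \<bullet> e) * (u \<bullet> v)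
      - (e \<bullet> u) * (d \<bullet> v) - (d \<bullet> u) * (e \<bullet> v) + (A e \<bullet> u) * (A d \<bullet> v) + (A d \<bullet> u) * (A e \<bullet> v))) (at 0)" for e u v
    unfolding killing_form_deriv_def
    by (rule has_derivative_eq_rhs, (rule derivative_intros has_derivative_field)+) (simp add: w0 fun_eq_iff)
  have lin: "((\<lambda>y. k * (y \<bullet> e)) has_derivative (\<lambda>d. k * (d \<bullet> e))) (at 0)" for k and e :: "real^'n"
    by (auto intro!: derivative_eq_intros)
  have r: "((\<lambda>y. 1 + y \<bullet> y) has_derivative (\<lambda>d. 0)) (at (0::real^'n))"
    by (auto intro!: derivative_eq_intros)
  have s: "((\<lambda>y. 1 + y \<bullet> y + bivector_norm w y) has_derivative (\<lambda>d. 0)) (at 0)"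
    by (rule has_derivative_eq_rhs[OF has_derivative_add[OF r has_derivative_bivector_norm]])
      (simp add: bd0)
  have ld: "((\<lambda>y. log_factor_deriv y e) has_derivative (\<lambda>d. - 4 / (real CARD('n) - 1) *
      ((real CARD('n) - 1) * (d \<bullet> e) + A d \<bullet> A e))) (at 0)" for e
  proof -
    have 1: "((\<lambda>y. real (CARD('n) - 2) * (2 * (y \<bullet> e)) / (1 + y \<bullet> y)) has_derivative
        (\<lambda>d. real (CARD('n) - 2) * (2 * (d \<bullet> e)))) (at 0)"
      by (rule has_derivative_eq_rhs[OF has_derivative_divide'[OF has_derivative_mult_right[OF lin] r]]) auto
    have 2: "((\<lambda>y. (2 * (y \<bullet> e) + bivector_norm_deriv y e) / (1 + y \<bullet> y + bivector_norm w y))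
        has_derivative (\<lambda>d. 2 * (d \<bullet> e) + 2 * (A d \<bullet> A e))) (at 0)"
      by (rule has_derivative_eq_rhs[OF has_derivative_divide'[OF has_derivative_add[OF lin bd] s]])
        (auto simp: q0)
    show ?thesis unfolding log_factor_deriv_def
      by (rule has_derivative_eq_rhs[OF has_derivative_mult_right[OF has_derivative_add[OF 1 2]]])
        (use n in \<open>simp add: of_nat_diff fun_eq_iff field_simps\<close>)
  qed
  interpret metric_jet "killing_metric w" metric_deriv 0 H
  proof
    fix i j l :: 'n and d y
    show "(killing_metric w has_derivative metric_deriv y) (at y)"
      by (rule has_derivative_killing_metric)
    show "(\<lambda>y. matrix_inv (killing_metric w y)) differentiable at 0"
      by (rule differentiable_matrix_inv_killing_metric)
    show "killing_metric w 0 = mat 1"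
      by (simp add: killing_metric_def c0 k0 vec_eq_iff mat_def inner_axis_axis)
    show "metric_deriv 0 d = 0"
      by (simp add: metric_deriv_def c0 k0 ld0 kd0 vec_eq_iff)
    show "((\<lambda>y. metric_deriv y (axis i 1) $ j $ l) has_derivative H i j l) (at 0)"
      unfolding metric_deriv_def vec_lambda_beta
      by (rule has_derivative_eq_rhs[OF has_derivative_mult[OF has_derivative_conformal_factor
            has_derivative_add[OF has_derivative_mult[OF ld has_derivative_killing_form] kd]]])
        (simp add: c0 k0 ld0 kd0 H_def fun_eq_iff)
  qed
  have "A (axis b 1) \<bullet> axis a 1 = - (A (axis a 1) \<bullet> axis b 1)"
    "A (axis a 1) \<bullet> axis a 1 = 0" "A (axis b 1) \<bullet> axis b 1 = 0"
    using skew[of "axis b 1" "axis a 1"] skew[of "axis a 1" "axis a 1"] skew[of "axis b 1" "axis b 1"]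
    by auto
  moreover have "axis a (1::real) \<bullet> axis b 1 = 0" "axis b (1::real) \<bullet> axis a 1 = 0"
    using assms(3) by (simp_all add: inner_axis_axis)
  moreover define m where "m = real CARD('n) - 1"
  moreover have "m \<noteq> 0" using n by (simp add: m_def)
  ultimately show ?thesis
    unfolding sectional_curvature_axes[OF assms(3)] H_def m_def[symmetric]
    using assms(3) by (simp add: inner_axis_axis power2_eq_square field_simps)
qed

section \<open>Smoothness and positivity of the metric in one chart\<close>

lemma (in killing_field) is_metric_on_killing_metric: "is_metric_on UNIV (killing_metric w)"
proof -
  have id: "smooth_map_on UNIV (\<lambda>x::real^'n. x)"
    by (rule smooth_map_on_bounded_linear[OF open_UNIV bounded_linear_ident])
  have "w = (\<lambda>x. w 0 + A x)" using affine by blast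
  moreover have "smooth_map_on UNIV (\<lambda>x. w 0 + A x)"
    by (intro smooth_map_on_add smooth_map_on_const smooth_map_on_bounded_linear open_UNIV
        bounded_linear)
  ultimately have w: "smooth_map_on UNIV w" by simp
  note intros = open_UNIV id w smooth_map_on_const smooth_map_on_add smooth_map_on_mult
    smooth_map_on_inner smooth_map_on_power
  have q: "smooth_map_on UNIV (bivector_norm w)"
    unfolding bivector_norm_def[abs_def] by (intro intros)
  have c: "smooth_map_on UNIV (conformal_factor w)"
    unfolding conformal_factor_def[abs_def]
    by (intro smooth_map_on_powr conformal_base_pos intros q)
  have k: "smooth_map_on UNIV (\<lambda>x. killing_form w x u v)" for u v
  proof -
    \<comment> \<open>The difference is written as a sum with factor \<open>- 1\<close> to fit the
      closure rules for sums and products.\<close>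
    have "killing_form w x u v = (1 + x \<bullet> x) * (u \<bullet> v) + (- 1) * ((x \<bullet> u) * (x \<bullet> v)) + (w x \<bullet> u) * (w x \<bullet> v)" for x
      by (simp add: killing_form_def)
    then show ?thesis by (simp only:) (intro intros)
  qed
  have "smooth_map_on UNIV (killing_metric w)"
  proof (rule smooth_map_on_euclidean[OF open_UNIV])
    fix b :: "real^'n^'n" assume "b \<in> Basis"
    then obtain j k where b: "b = axis j (axis k 1)" by (auto simp: Basis_vec_def)
    have "(\<lambda>x. killing_metric w x \<bullet> b) =
        (\<lambda>x. conformal_factor w x * killing_form w x (axis j 1) (axis k 1))"
      by (simp add: b inner_axis killing_metric_def)
    then show "smooth_map_on UNIV (\<lambda>x. killing_metric w x \<bullet> b)"
      by (simp only:) (intro smooth_map_on_mult open_UNIV c k)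
  qed
  then show ?thesis
    by (simp add: is_metric_on_def transpose_killing_metric killing_metric_pos)
qed

section \<open>Descent to projective space\<close>

definition lift :: "'n::finite option \<Rightarrow> real^'n \<Rightarrow> real^('n option)" where
  "lift i u = (\<chi> j. if j = i then 0 else u $ inv (slot i) j)"

definition rest :: "'n::finite option \<Rightarrow> real^('n option) \<Rightarrow> real^'n" where
  "rest i Y = (\<chi> l. Y $ slot i l)"

text \<open>The infinitesimal rotation in the (a, b)-plane. Its pairing with a vector U is X_a U_b -
  X_b U_a, a single coordinate of the bivector of X and U.\<close>

definition plane_rotation :: "'n::finite \<Rightarrow> 'n \<Rightarrow> real^'n \<Rightarrow> real^'n" where
  "plane_rotation a b X = X $ a *\<^sub>R axis b 1 - X $ b *\<^sub>R axis a 1"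

lemma inner_slot: "Y \<bullet> Z = Y $ i * Z $ i + rest i Y \<bullet> rest i Z"
proof -
  have "UNIV = insert i (range (slot i))"
    using bij_betw_slot[of i] by (auto simp: bij_betw_def)
  moreover have "i \<notin> range (slot i)" using slot_neq[of i] by (metis imageE)
  ultimately have "Y \<bullet> Z = Y $ i * Z $ i + (\<Sum>j\<in>range (slot i). Y $ j * Z $ j)"
    by (simp add: inner_vec_def) (metis (no_types, lifting) finite sum.insert)
  also have "(\<Sum>j\<in>range (slot i). Y $ j * Z $ j) = (\<Sum>l\<in>UNIV. Y $ slot i l * Z $ slot i l)"
    using sum.reindex[OF inj_slot[of i]] by simp
  finally show ?thesis by (simp add: inner_vec_def rest_def)
qed

lemma lift_nth [simp]: "lift i u $ i = 0"
  by (simp add: lift_def)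

lemma rest_lift [simp]: "rest i (lift i u) = u"
  by (simp add: rest_def lift_def vec_eq_iff slot_neq inv_f_f[OF inj_slot])

lemma inner_lift: "Y \<bullet> lift i u = rest i Y \<bullet> u"
  by (simp add: inner_slot[of _ _ i])

lemma rest_inner: "rest i Y \<bullet> u = Y \<bullet> lift i u"
  by (simp add: inner_lift)

lemma linear_lift: "linear (lift i)"
  by (auto simp: linear_iff lift_def vec_eq_iff)

lemma linear_rest: "linear (rest i)"
  by (auto simp: linear_iff rest_def vec_eq_iff)

lemma linear_plane_rotation: "linear (plane_rotation a b)"
  by (auto simp: linear_iff plane_rotation_def algebra_simps)

lemma plane_rotation_skew: "plane_rotation a b X \<bullet> Y = - (plane_rotation a b Y \<bullet> X)"
  by (simp add: plane_rotation_def inner_diff_left inner_axis')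

lemma homogenize_nth [simp]: "homogenize i x $ i = 1"
  by (simp add: homogenize_def)

lemma rest_homogenize [simp]: "rest i (homogenize i x) = x"
  by (simp add: rest_def homogenize_def vec_eq_iff slot_neq inv_f_f[OF inj_slot])

lemma homogenize_eq: "homogenize i x = axis i 1 + lift i x"
  by (auto simp: homogenize_def lift_def axis_def vec_eq_iff)

lemma has_derivative_homogenize: "(homogenize i has_derivative lift i) (at x)"
proof -
  have "((\<lambda>x. axis i 1 + lift i x) has_derivative lift i) (at x)"
    using linear_lift[of i]
    by (auto intro!: derivative_eq_intros bounded_linear_imp_has_derivative
        simp: linear_conv_bounded_linear)
  then show ?thesis by (simp add: homogenize_eq[abs_def])
qed

text \<open>The i-th component may be dropped because the field is only paired with lifted tangent
  vectors, whose i-th entry is 0.\<close>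

definition chart_field :: "'n option \<Rightarrow> 'n option \<Rightarrow> 'n option \<Rightarrow> real^'n \<Rightarrow> real^'n::finite" where
  "chart_field a b i x = rest i (plane_rotation a b (homogenize i x))"

text \<open>\<open>rest i\<close> is adjoint to \<open>lift i\<close>, so compressing the skew map
  between them keeps it skew.\<close>

lemma killing_field_chart_field:
  fixes i :: "'n::finite option"
  shows "killing_field (chart_field a b i) (\<lambda>u. rest i (plane_rotation a b (lift i u)))"
proof (rule killing_field.intro)
  fix x u v :: "real^'n"
  have "homogenize i x = homogenize i 0 + lift i x"
    by (simp add: homogenize_eq linear_0[OF linear_lift])
  then show "chart_field a b i x = chart_field a b i 0 + rest i (plane_rotation a b (lift i x))"
    by (simp add: chart_field_def linear_add[OF linear_rest] linear_add[OF linear_plane_rotation])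
  show "linear (\<lambda>u. rest i (plane_rotation a b (lift i u)))"
    using linear_compose[OF linear_compose[OF linear_lift linear_plane_rotation] linear_rest]
    by (simp add: o_def)
  show "rest i (plane_rotation a b (lift i u)) \<bullet> v = - (rest i (plane_rotation a b (lift i v)) \<bullet> u)"
    using plane_rotation_skew by (simp add: rest_inner)
qed

text \<open>The homogeneous extensions to \<open>\<real>\<^sup>n\<^sup>+\<^sup>1\<close>; their degrees in \<open>X\<close> cancel, which is why the chart metrics
  agree on overlaps.\<close>

definition cone_form ::
    "'n \<Rightarrow> 'n \<Rightarrow> real^'n \<Rightarrow> real^'n \<Rightarrow> real^'n \<Rightarrow> real" where
  "cone_form a b X U V = (X \<bullet> X) * (U \<bullet> V) - (X \<bullet> U) * (X \<bullet> V) +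
     (plane_rotation a b X \<bullet> U) * (plane_rotation a b X \<bullet> V)"

definition cone_factor :: "nat \<Rightarrow> 'n \<Rightarrow> 'n \<Rightarrow> real^'n \<Rightarrow> real" where
  "cone_factor n a b X = ((X \<bullet> X) ^ (n - 2) *
     (X \<bullet> X + plane_rotation a b X \<bullet> plane_rotation a b X)) powr (- 2 / (real n - 1))"

lemma inner_homogenize: "homogenize i x \<bullet> homogenize i x = 1 + x \<bullet> x"
  by (simp add: inner_slot[of _ _ i])

text \<open>The chart now enters only through the representative \<open>homogenize i x\<close> and
  the lifted vectors, which reduces changes of chart to rescaling.\<close>

lemma ginner_chart_field:
  fixes x :: "real^'n::finite"
  shows "ginner (killing_metric (chart_field a b i)) x u v =
    cone_factor CARD('n) a b (homogenize i x) * cone_form a b (homogenize i x) (lift i u) (lift i v)"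
proof -
  let ?X = "homogenize i x" let ?W = "plane_rotation a b ?X"
  have "?W $ i + chart_field a b i x \<bullet> x = 0"
    using plane_rotation_skew[of a b ?X ?X] inner_slot[of ?W ?X i] by (simp add: chart_field_def)
  then have "?W \<bullet> ?W = bivector_norm (chart_field a b i) x"
    by (simp add: inner_slot[of ?W ?W i] bivector_norm_def chart_field_def inner_commute[of x]
        power2_eq_square eq_neg_iff_add_eq_0[symmetric])
  then have "conformal_factor (chart_field a b i) x = cone_factor CARD('n) a b ?X"
    by (simp add: conformal_factor_def cone_factor_def inner_homogenize)
  moreover have "killing_form (chart_field a b i) x u v = cone_form a b ?X (lift i u) (lift i v)"
    by (simp add: killing_form_def cone_form_def inner_homogenize inner_lift chart_field_def)
  ultimately show ?thesis
    by (simp add: ginner_def inner_killing_metric)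
qed

text \<open>Multiples of \<open>X\<close> added to the tangent vectors do not change the bivectors
  they form with \<open>X\<close>. The form is quadratic in \<open>X\<close> and bilinear in the
  other two, hence the fourth power.\<close>

lemma cone_form_rescale:
  "cone_form a b (c *\<^sub>R X) (c *\<^sub>R U + k *\<^sub>R X) (c *\<^sub>R V + l *\<^sub>R X) = c ^ 4 * cone_form a b X U V"
proof -
  have "plane_rotation a b (c *\<^sub>R X) = c *\<^sub>R plane_rotation a b X"
    by (rule linear_cmul[OF linear_plane_rotation])
  moreover have "plane_rotation a b X \<bullet> X = 0"
    using plane_rotation_skew[of a b X X] by simp
  ultimately show ?thesis
    by (simp add: cone_form_def inner_add_right inner_add_left inner_commute[of U X] inner_commute[of V X]
        power4_eq_xxxx algebra_simps)
qed

text \<open>The base is homogeneous of degree 2 (n - 1), so the exponent - 2 / (n - 1) yields degree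
  - 4, exactly opposite to \<open>cone_form\<close>. Powers are taken of \<open>c\<^sup>2\<close>
  because \<open>c\<close> may be negative.\<close>

lemma cone_factor_rescale:
  assumes "c \<noteq> 0" "n \<ge> 2"
  shows "cone_factor n a b (c *\<^sub>R X) = cone_factor n a b X / c ^ 4"
proof -
  define B where "B = (X \<bullet> X) ^ (n - 2) * (X \<bullet> X + plane_rotation a b X \<bullet> plane_rotation a b X)"
  have c2: "c\<^sup>2 > 0" using assms(1) by simp
  have "B \<ge> 0" by (simp add: B_def)
  have "plane_rotation a b (c *\<^sub>R X) = c *\<^sub>R plane_rotation a b X"
    by (rule linear_cmul[OF linear_plane_rotation])
  then have "cone_factor n a b (c *\<^sub>R X) = ((c\<^sup>2) ^ (n - 2) * c\<^sup>2 * B) powr (- 2 / (real n - 1))"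
    by (simp add: cone_factor_def B_def power_mult_distrib power2_eq_square algebra_simps)
  also have "(c\<^sup>2) ^ (n - 2) * c\<^sup>2 = (c\<^sup>2) powr (real n - 1)"
  proof -
    have "(c\<^sup>2) ^ (n - 2) * c\<^sup>2 = (c\<^sup>2) ^ (n - 1)"
      using assms(2) by (metis One_nat_def Suc_1 Suc_diff_Suc Suc_le_lessD power_Suc2)
    also have "\<dots> = (c\<^sup>2) powr (real (n - 1))"
      using c2 by (simp add: powr_realpow)
    finally show ?thesis using assms(2) by (simp add: of_nat_diff)
  qed
  also have "((c\<^sup>2) powr (real n - 1) * B) powr (- 2 / (real n - 1)) =
      (c\<^sup>2) powr (- 2) * cone_factor n a b X"
  proof -
    have nz: "real n - 1 \<noteq> 0" using assms(2) by simp
    have "(real n - 1) * (- 2 / (real n - 1)) = - 2"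
      by (simp only: times_divide_eq_right nonzero_mult_div_cancel_left[OF nz])
    then show ?thesis
      using \<open>B \<ge> 0\<close> by (simp only: powr_mult powr_powr cone_factor_def B_def zero_le_power2)
  qed
  also have "(c\<^sup>2) powr (- 2) = 1 / c ^ 4"
  proof -
    have "(c\<^sup>2) powr (- 2) = 1 / (c\<^sup>2) powr (real 2)"
      by (simp add: powr_minus_divide)
    also have "\<dots> = 1 / c ^ 4"
      using c2 by (subst powr_realpow) simp_all
    finally show ?thesis .
  qed
  finally show ?thesis by simp
qed

section \<open>Transition maps between the affine charts\<close>

lemma param_mem_chart_domain_iff: "param i x \<in> chart_domain j \<longleftrightarrow> homogenize i x $ j \<noteq> 0"
proof -
  have "param i x \<in> RP"
    using param_in_chart_domain[of i x] by (simp add: chart_domain_def)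
  then show ?thesis
    by (auto simp: chart_domain_def param_def proj_class_def homogenize_nonzero)
qed

lemma chart_param_transition:
  "chart j (param i y) = (\<chi> l. homogenize i y $ slot j l / homogenize i y $ j)"
  by (simp add: param_def chart_proj_class homogenize_nonzero)

lemma has_derivative_transition:
  fixes i j :: "'n::finite option"
  assumes "homogenize i x $ j \<noteq> 0"
  shows "((\<lambda>y. chart j (param i y)) has_derivative (\<lambda>u. \<chi> l.
    (lift i u $ slot j l * homogenize i x $ j - homogenize i x $ slot j l * lift i u $ j) /
      (homogenize i x $ j * homogenize i x $ j))) (at x)"
proof (rule has_derivative_componentwise_vec)
  fix l
  have h: "((\<lambda>y. homogenize i y $ m) has_derivative (\<lambda>u. lift i u $ m)) (at x)" for m
    by (intro bounded_linear.has_derivative[OF bounded_linear_vec_nth] has_derivative_homogenize)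
  show "((\<lambda>y. chart j (param i y) $ l) has_derivative (\<lambda>u. (\<chi> l.
      (lift i u $ slot j l * homogenize i x $ j - homogenize i x $ slot j l * lift i u $ j) /
      (homogenize i x $ j * homogenize i x $ j)) $ l)) (at x)"
    unfolding chart_param_transition vec_lambda_beta
    by (rule has_derivative_divide'[OF h h assms])
qed

lemma is_riemannian_metric_RP_chart_field:
  assumes "CARD('n::finite) \<ge> 2"
  shows "is_riemannian_metric_RP (\<lambda>i :: 'n option. killing_metric (chart_field a b i))"
  unfolding is_riemannian_metric_RP_def Let_def
proof (intro conjI allI impI)
  fix i show "is_metric_on UNIV (killing_metric (chart_field a b i))"
    by (rule killing_field.is_metric_on_killing_metric[OF killing_field_chart_field])
next
  fix i j :: "'n option" and x u v :: "real^'n"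
  assume "param i x \<in> chart_domain j"
  then have Xj: "homogenize i x $ j \<noteq> 0" by (simp add: param_mem_chart_domain_iff)
  define X where "X = homogenize i x"
  define c where "c = 1 / X $ j"
  define T where "T = frechet_derivative (\<lambda>y. chart j (param i y)) (at x)"
  have c: "c \<noteq> 0" "c * X $ j = 1" using Xj by (simp_all add: c_def X_def)
  have T: "T u = (\<chi> l. (lift i u $ slot j l * X $ j - X $ slot j l * lift i u $ j) / (X $ j * X $ j))" for u
    unfolding T_def frechet_derivative_at[OF has_derivative_transition[OF Xj], symmetric] X_def ..
  \<comment> \<open>This is the derivative of X / X_j: a rescaled tangent vector plus a multiple of
    \<open>X\<close>, the shape required by \<open>cone_form_rescale\<close>.\<close>
  have lift_T: "lift j (T u) = c *\<^sub>R lift i u + (- (c * c * lift i u $ j)) *\<^sub>R X" for u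
  proof -
    have "lift j (T u) $ m = (c *\<^sub>R lift i u + (- (c * c * lift i u $ j)) *\<^sub>R X) $ m" for m
    proof (cases "m = j")
      case True
      then show ?thesis using c(2) by (simp add: algebra_simps)
    next
      case False
      then show ?thesis
        using Xj by (simp add: lift_def[of j] T slot_inv c_def X_def[symmetric] field_simps)
    qed
    then show ?thesis by (simp add: vec_eq_iff)
  qed
  have X': "homogenize j (chart j (param i x)) = c *\<^sub>R X"
    unfolding chart_param_transition using c
    by (auto simp: vec_eq_iff homogenize_def[of j] slot_inv c_def X_def)
  show "ginner (killing_metric (chart_field a b i)) x u v =
      ginner (killing_metric (chart_field a b j)) (chart j (param i x))
        (frechet_derivative (\<lambda>y. chart j (param i y)) (at x) u)
        (frechet_derivative (\<lambda>y. chart j (param i y)) (at x) v)"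
    unfolding ginner_chart_field T_def[symmetric] lift_T X' cone_form_rescale
      cone_factor_rescale[OF c(1) assms] X_def[symmetric]
    using c(1) by simp
qed

section \<open>Equators as affine hyperplanes in the charts\<close>

lemma param_mem_equator_iff:
  "param i y \<in> proj_class ` sphere_equator v \<longleftrightarrow> homogenize i y \<bullet> v = 0"
proof -
  let ?X = "homogenize i y"
  have "param i y \<in> proj_class ` sphere_equator v \<longleftrightarrow> (?X /\<^sub>R norm ?X) \<in> sphere_equator v"
  proof
    assume "param i y \<in> proj_class ` sphere_equator v"
    then obtain p where "p \<in> sphere_equator v" "{p, - p} = {?X /\<^sub>R norm ?X, - (?X /\<^sub>R norm ?X)}"
      unfolding param_def proj_class_def by auto
    then show "(?X /\<^sub>R norm ?X) \<in> sphere_equator v"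
      by (auto simp: sphere_equator_def doubleton_eq_iff)
  qed (simp add: param_def)
  then show ?thesis by (simp add: sphere_equator_def homogenize_nonzero)
qed

lemma is_minimal_hypersurface_RP_equator:
  assumes n: "CARD('n::finite) \<ge> 2" and \<Sigma>: "\<Sigma> \<in> RP_equators"
  shows "is_minimal_hypersurface_RP (\<lambda>i :: 'n option. killing_metric (chart_field a b i)) \<Sigma>"
proof -
  obtain v where v: "\<Sigma> = proj_class ` sphere_equator v" "v \<in> sphere 0 1"
    using \<Sigma> by (auto simp: RP_equators_def)
  show ?thesis
    unfolding is_minimal_hypersurface_RP_def
  proof (intro conjI allI impI)
    show "\<Sigma> \<subseteq> RP" by (auto simp: v(1) RP_def sphere_equator_def)
  next
    fix i :: "'n option" and x assume "param i x \<in> \<Sigma>"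
    then have x: "homogenize i x \<bullet> v = 0" by (simp add: v(1) param_mem_equator_iff)
    define f where "f = (\<lambda>y. rest i v \<bullet> y + v $ i)"
    have f: "homogenize i y \<bullet> v = f y" for y
      by (simp add: inner_slot[of _ _ i] f_def inner_commute)
    \<comment> \<open>A vanishing linear part would make the equator the hyperplane at infinity of
      chart \<open>i\<close>, which contains no point of the chart; \<open>x\<close> rules this
      out.\<close>
    have nz: "rest i v \<noteq> 0"
    proof
      assume 0: "rest i v = 0"
      then have "v $ i = 0" using x f[of x] by (simp add: f_def)
      then have "v \<bullet> v = 0" using 0 by (simp add: inner_slot[of _ _ i])
      then show False using v(2) by simp
    qed
    have smooth: "smooth_map_on UNIV f"
      unfolding f_def
      by (intro smooth_map_on_add smooth_map_on_const smooth_map_on_bounded_linear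
          bounded_linear_inner_right open_UNIV)
    have "frechet_derivative f (at y) = (\<lambda>d. rest i v \<bullet> d)" for y
      unfolding f_def by (rule frechet_derivative_at[OF has_derivative_affine_functional, symmetric])
    moreover have "rest i v \<bullet> rest i v \<noteq> 0" using nz by simp
    ultimately have "frechet_derivative f (at y) \<noteq> (\<lambda>_. 0)" for y by metis
    moreover have "zero_mean_curvature_at (killing_metric (chart_field a b i)) f y" for y
      by (rule killing_field.zero_mean_curvature_affine[OF killing_field_chart_field n nz])
        (simp add: f_def)
    moreover have "param i y \<in> \<Sigma> \<longleftrightarrow> f y = 0" for y
      by (simp add: v(1) param_mem_equator_iff f)
    ultimately show "\<exists>V f. open V \<and> x \<in> V \<and> smooth_map_on V f \<and>
        (\<forall>y\<in>V. frechet_derivative f (at y) \<noteq> (\<lambda>_. 0)) \<and>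
        {y \<in> V. param i y \<in> \<Sigma>} = {y \<in> V. f y = 0} \<and>
        (\<forall>y\<in>V. f y = 0 \<longrightarrow> zero_mean_curvature_at (killing_metric (chart_field a b i)) f y)"
      using smooth by (intro exI[of _ UNIV] exI[of _ f]) auto
  qed
qed

text \<open>At one point the rotation plane (a, b) and the plane (a, c), which meets it only in a
  line, have different curvatures.\<close>

lemma not_constant_sectional_curvature_chart_field:
  fixes a b c :: "'n::finite"
  assumes "a \<noteq> b" "c \<noteq> a" "c \<noteq> b"
  shows "\<not> has_constant_sectional_curvature_RP
    (\<lambda>i. killing_metric (chart_field (Some a) (Some b) i))"
proof
  let ?w = "chart_field (Some a) (Some b) None"
  let ?A = "\<lambda>u. rest None (plane_rotation (Some a) (Some b) (lift None u))"
  assume "has_constant_sectional_curvature_RP (\<lambda>i. killing_metric (chart_field (Some a) (Some b) i))"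
  then obtain k where k: "\<And>i x u v. u \<noteq> v \<Longrightarrow> independent {u, v} \<Longrightarrow>
      sectional_curvature (killing_metric (chart_field (Some a) (Some b) i)) x u v = k"
    unfolding has_constant_sectional_curvature_RP_def by blast
  have "card {a, b, c} \<le> CARD('n)" by (intro card_mono) auto
  then have n: "CARD('n) \<ge> 3" using assms by simp
  interpret killing_field ?w ?A by (rule killing_field_chart_field)
  have slot: "slot None l = Some l" for l :: 'n by (simp add: slot_def)
  have inv_slot: "inv (slot None) (Some l) = l" for l :: 'n
    using inv_f_f[OF inj_slot, of None l] by (simp add: slot)
  have A: "?A u = u $ a *\<^sub>R axis b 1 - u $ b *\<^sub>R axis a 1" for u
    by (simp add: vec_eq_iff rest_def plane_rotation_def lift_def slot inv_slot axis_def)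
  \<comment> \<open>The rotation plane avoids the coordinate \<open>None\<close>, so the rotation
    annihilates the representative of this chart's origin.\<close>
  have w0: "?w 0 = 0"
    by (simp add: chart_field_def vec_eq_iff rest_def plane_rotation_def homogenize_def slot inv_slot)
  have k_axis: "sectional_curvature (killing_metric ?w) 0 (axis p 1) (axis q 1) = k" if "p \<noteq> q" for p q
  proof (rule k)
    show "axis p (1::real) \<noteq> axis q 1" using that by (simp add: axis_eq_axis)
    have "{axis p (1::real), axis q 1} \<subseteq> Basis" by (auto simp: axis_in_Basis_iff)
    then show "independent {axis p (1::real), axis q 1}"
      using independent_Basis independent_mono by blast
  qed
  have axis_nth: "axis p (1::real) $ q = (if p = q then 1 else 0)" for p q :: 'n
    by (simp add: axis_def)
  have "1 - 3 + 2 / (real CARD('n) - 1) * 2 = k"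
    using k_axis[OF assms(1)] sectional_curvature_origin[OF w0 _ assms(1)] n assms
    by (simp add: A axis_nth inner_axis_axis)
  moreover have "1 + 2 / (real CARD('n) - 1) = k"
    using k_axis[OF assms(2)[symmetric]] sectional_curvature_origin[OF w0 _ assms(2)[symmetric]] n assms
    by (simp add: A axis_nth inner_axis_axis)
  \<comment> \<open>Equating - 2 + 4 / (n - 1) with 1 + 2 / (n - 1) would force n - 1 = 2 /
    3.\<close>
  ultimately have "2 / (real CARD('n) - 1) = 3" by linarith
  then show False using n by (simp add: field_simps)
qed

theorem mainTheorem6:
  assumes "CARD('n::finite) \<ge> 3"
  shows "\<exists>G :: 'n RP_tensor.
           is_riemannian_metric_RP G \<and>
           (\<forall>\<Sigma>\<in>RP_equators. is_minimal_hypersurface_RP G \<Sigma>) \<and>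
           \<not> has_constant_sectional_curvature_RP G"
proof -
  obtain S :: "'n set" where "card S = 3"
    using obtain_subset_with_card_n[OF assms] by metis
  then obtain a b c where "a \<noteq> b" "c \<noteq> a" "c \<noteq> (b :: 'n)"
    by (auto simp: card_3_iff)
  then show ?thesis
    using assms is_riemannian_metric_RP_chart_field[of "Some a" "Some b"]
      is_minimal_hypersurface_RP_equator[of _ "Some a" "Some b"]
      not_constant_sectional_curvature_chart_field[of a b c]
    by (intro exI[of _ "\<lambda>i. killing_metric (chart_field (Some a) (Some b) i)"]) auto
qed

end
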